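(* For every positive integer $d$ there exist positive constants $c_d, C_d$ (depending only on $d$) such that for all positive integers $N_1,\dots,N_d$ with $N_1\cdots N_d\ge 3$, letting $\mathbf{N}=(N_1,\dots,N_d)$, \[ c_d\max_{I\subseteq[d]}\Big(\prod_{i\in I}N_i\Big)^{\frac{1}{2|I|+2}} \le \operatorname{disc}(\mathcal{A}_{\mathbf{N}}) \le C_d\,\frac{\log(N_1\cdots N_d)}{\log\log(N_1\cdots N_d)}\cdot\max_{I\subseteq[d]}\Big(\prod_{i\in I}N_i\Big)^{\frac{1}{2|I|+2}}, \] where for $I=\emptyset$ the product $\prod_{i\in I}N_i$ is taken to be $1$.
   Context: For $N\in\mathbb{N}$ write $[N]=\{1,\dots,N\}$; logarithms are natural. An arithmetic progression in $d$ dimensions is a set $\{\mathbf{a}+i\mathbf{b}: i=0,1,\dots,l-1\}$ with $\mathbf{a},\mathbf{b}\in\mathbb{Z}^d$, $\mathbf{b}\neq\mathbf{0}$, $l\in\mathbb{N}$. For $\mathbf{N}=(N_1,\dots,N_d)$, let $\Omega=[N_1]\times\cdots\times[N_d]$ and let $\mathcal{A}_{\mathbf{N}}$ be the family of arithmetic progressions in $d$ dimensions contained in $\Omega$. For $\chi:\Omega\to\{1,-1\}$ and $A\subseteq\Omega$ put $\chi(A)=\sum_{x\in A}\chi(x)$, and $\operatorname{disc}(\mathcal{A}_{\mathbf{N}})=\min_{\chi:\Omega\to\{1,-1\}}\max_{A\in\mathcal{A}_{\mathbf{N}}}|\chi(A)|$. *)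

theory Defs
  imports Complex_Main "HOL-Library.FuncSet"
begin

text \<open>Points of Z^d are represented as functions nat => int vanishing outside {0..<d};
  coordinate i (0-based) corresponds to coordinate i+1 of the paper.\<close>

definition grid :: "nat \<Rightarrow> (nat \<Rightarrow> nat) \<Rightarrow> (nat \<Rightarrow> int) set" where
  "grid d N = {x. (\<forall>i<d. 1 \<le> x i \<and> x i \<le> int (N i)) \<and> (\<forall>i\<ge>d. x i = 0)}"

definition zvec :: "nat \<Rightarrow> (nat \<Rightarrow> int) set" where
  "zvec d = {x. \<forall>i\<ge>d. x i = 0}"

definition ap_set :: "(nat \<Rightarrow> int) \<Rightarrow> (nat \<Rightarrow> int) \<Rightarrow> nat \<Rightarrow> (nat \<Rightarrow> int) set" where
  "ap_set a b l = {(\<lambda>j. a j + int i * b j) | i. i < l}"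

definition APs :: "nat \<Rightarrow> (nat \<Rightarrow> nat) \<Rightarrow> (nat \<Rightarrow> int) set set" where
  "APs d N = {ap_set a b l | a b l. a \<in> zvec d \<and> b \<in> zvec d \<and> b \<noteq> (\<lambda>_. 0) \<and> l \<ge> 1
                \<and> ap_set a b l \<subseteq> grid d N}"

definition disc_AP :: "nat \<Rightarrow> (nat \<Rightarrow> nat) \<Rightarrow> int" where
  "disc_AP d N = Min ((\<lambda>\<chi>. Max ((\<lambda>A. \<bar>\<Sum>x\<in>A. \<chi> x\<bar>) ` APs d N))
                      ` (grid d N \<rightarrow>\<^sub>E {1, -1}))"

end

theory Submission
  imports Defs "HOL-Analysis.Analysis"
begin

text \<open>
  Write M for the maximum and L = M^2.

  Upper bound. Progressions with at most about L terms are sums of at most L points. Longer ones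
  have a difference b with L |b_i| bounded by N_i for all i, and there are only O(L) such b; on each
  residue class modulo b they are cut into blocks of length L and blocks of k_b times that length,
  plus O(L) single points. Suitable weights on points and blocks factor the incidence matrix
  through Euclidean vectors whose norms have product O(sqrt L). A derandomised Gram--Schmidt walk
  then yields signs with subgaussian behaviour on all of the polynomially many progressions, which
  costs a factor sqrt (log P), smaller than log P / log log P.

  Lower bound. For the index set I attaining the maximum every side N_i with i in I is at least L.
  By the pigeonhole principle every frequency has a nearly resonant difference b with L |b_i|
  at most N_i, and Parseval's identity bounds the mean square of the sums of the colouring over
  progressions with about L / 12 terms from below by a multiple of L.
\<close>

section \<open>Orthogonal projection onto finite spans\<close>

text \<open>The upper bound knows the sides only through one fact: every subproduct over an index
  set J is at most L^(|J|+1). It leaves O(L/m) nonzero differences b with L m |b_i| <= N_i for all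
  i. One block length would not do, because a progression may need all n blocks on its line. With a
  second level of ratio k_b, about sqrt n, it needs O(k_b) blocks. Give each the weight k_b / L: a
  progression then costs O(L), and a point pays a constant plus the sum of O(k_b / L) over b. That
  sum is bounded since only O(L / k^2) differences have k_b > k, and the series converges. The
  signing must not depend on the number of points or on the dimension. This is why the potential of
  the walk contains the energy of a projection: it is the variance that the undecided vectors can
  still produce, and it starts at no more than the squared norm of the test vector. In the lower
  bound there are O(L) differences, and the starting points are at most a constant times as many as
  the points of the slice. Averaging an energy of order L^2 per point over both leaves a mean square
  of order L.\<close>

lemma orthogonal_projection_exists:
  fixes y :: "'a::real_inner"
  assumes "finite B"
  shows "\<exists>p\<in>span B. \<forall>z\<in>span B. inner (y - p) z = 0"
  using assms
proof (induction B arbitrary: y rule: finite_induct)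
  case empty
  then show ?case by simp
next
  case (insert b B)
  obtain pb where pb: "pb \<in> span B" "\<And>z. z \<in> span B \<Longrightarrow> inner (b - pb) z = 0"
    using insert.IH by blast
  obtain py where py: "py \<in> span B" "\<And>z. z \<in> span B \<Longrightarrow> inner (y - py) z = 0"
    using insert.IH by blast
  define w where "w = b - pb"
  \<comment> \<open>One Gram-Schmidt step. If \<open>b\<close> already lies in the span of
    \<open>B\<close>, then \<open>w\<close> is 0 and so is the quotient, so the same formula covers
    the dependent case.\<close>
  define p where "p = py + (inner y w / inner w w) *\<^sub>R w"
  have sub: "span B \<subseteq> span (insert b B)" by (rule span_mono) auto
  have w: "w \<in> span (insert b B)"
    unfolding w_def using pb(1) sub by (intro span_diff) (auto intro: span_base)
  have pin: "p \<in> span (insert b B)"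
    unfolding p_def using py(1) sub w by (intro span_add span_scale) auto
  have oz: "inner (y - p) z = 0" if "z \<in> span B" for z
    using py(2)[OF that] pb(2)[OF that] by (simp add: p_def w_def inner_simps)
  have ow: "inner (y - p) w = 0"
    using pb(2)[OF py(1)] 
    by (cases "w = 0") (simp_all add: p_def inner_simps, simp add: w_def inner_simps inner_commute)
  show ?case
  proof (intro bexI[OF _ pin] ballI)
    fix z assume "z \<in> span (insert b B)"
    then obtain k where k: "z - k *\<^sub>R b \<in> span B" by (auto simp: span_insert)
    have "z = ((z - k *\<^sub>R b) + k *\<^sub>R pb) + k *\<^sub>R w" by (simp add: w_def algebra_simps)
    moreover have "(z - k *\<^sub>R b) + k *\<^sub>R pb \<in> span B" using k pb(1) by (intro span_add span_scale)
    ultimately show "inner (y - p) z = 0" using oz ow by (metis inner_add_right inner_scaleR_right mult_zero_right add_0)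
  qed
qed

section \<open>Projections and the projected energy\<close>

definition proj_span :: "'a::real_inner set \<Rightarrow> 'a \<Rightarrow> 'a" where
  "proj_span B y = (SOME p. p \<in> span B \<and> (\<forall>z\<in>span B. inner (y - p) z = 0))"

lemma proj_span:
  assumes "finite B"
  shows proj_span_in: "proj_span B y \<in> span B"
    and proj_span_orth: "\<And>z. z \<in> span B \<Longrightarrow> inner (y - proj_span B y) z = 0"
proof -
  have "\<exists>p. p \<in> span B \<and> (\<forall>z\<in>span B. inner (y - p) z = 0)"
    using orthogonal_projection_exists[OF assms, of y] by blast
  from someI_ex[OF this]
  show "proj_span B y \<in> span B" "\<And>z. z \<in> span B \<Longrightarrow> inner (y - proj_span B y) z = 0"
    unfolding proj_span_def by blast+
qed

lemma proj_span_unique: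
  assumes "finite B" "p \<in> span B" "\<And>z. z \<in> span B \<Longrightarrow> inner (y - p) z = 0"
  shows "proj_span B y = p"
proof -
  let ?d = "proj_span B y - p"
  have d: "?d \<in> span B" using proj_span_in[OF assms(1)] assms(2) by (rule span_diff)
  have "inner ?d ?d = inner (y - p) ?d - inner (y - proj_span B y) ?d"
    by (simp add: inner_simps)
  also have "\<dots> = 0" using assms(3)[OF d] proj_span_orth[OF assms(1) d] by simp
  finally show ?thesis by simp
qed

text \<open>In the potential of the walk \<open>B\<close> consists of the undecided vectors, and
  this is the variance that the test vector \<open>y\<close> may still have to absorb.\<close>

definition proj_energy :: "'a::real_inner set \<Rightarrow> 'a \<Rightarrow> real" where
  "proj_energy B y = (norm (proj_span B y))\<^sup>2"

text \<open>The left side is maximal at the projection, where equality holds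
  (\<open>proj_energy_eq\<close>). A lower bound on an energy therefore needs only one well-chosen
  \<open>u\<close>.\<close>

lemma proj_energy_variational:
  assumes "finite B" "u \<in> span B"
  shows "2 * inner y u - inner u u \<le> proj_energy B y"
proof -
  have "inner y u = inner (proj_span B y) u"
    using proj_span_orth[OF assms] by (simp add: inner_simps)
  moreover have "0 \<le> inner (proj_span B y - u) (proj_span B y - u)" by simp
  ultimately show ?thesis
    by (simp add: proj_energy_def power2_norm_eq_inner inner_simps inner_commute)
qed

lemma proj_energy_eq:
  assumes "finite B"
  shows "proj_energy B y = 2 * inner y (proj_span B y) - inner (proj_span B y) (proj_span B y)"
  using proj_span_orth[OF assms proj_span_in[OF assms], of y y]
  by (simp add: proj_energy_def power2_norm_eq_inner inner_simps)

lemma proj_energy_mono: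
  assumes "finite C" "B \<subseteq> C"
  shows "proj_energy B y \<le> proj_energy C y"
proof -
  have fB: "finite B" using assms finite_subset by blast
  have "proj_span B y \<in> span C" using proj_span_in[OF fB] span_mono[OF assms(2)] by blast
  from proj_energy_variational[OF assms(1) this] show ?thesis
    by (simp add: proj_energy_eq[OF fB])
qed

lemma proj_energy_le_norm:
  assumes "finite B"
  shows "proj_energy B y \<le> (norm y)\<^sup>2"
proof -
  have "0 \<le> inner (y - proj_span B y) (y - proj_span B y)" by simp
  then show ?thesis
    by (simp add: proj_energy_eq[OF assms] power2_norm_eq_inner inner_simps inner_commute)
qed

lemma proj_span_insert:
  fixes v y :: "'a::real_inner"
  assumes "finite B"
  defines "w \<equiv> v - proj_span B v"
  shows "proj_span (insert v B) y = proj_span B y + (inner y w / inner w w) *\<^sub>R w"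
proof (rule proj_span_unique)
  have sub: "span B \<subseteq> span (insert v B)" by (rule span_mono) auto
  note pr = proj_span_in[OF assms(1)] proj_span_orth[OF assms(1)]
  have w: "w \<in> span (insert v B)"
    unfolding w_def using pr(1) sub by (intro span_diff) (auto intro: span_base)
  show "proj_span B y + (inner y w / inner w w) *\<^sub>R w \<in> span (insert v B)"
    using pr(1) sub w by (intro span_add span_scale) auto
  let ?p = "proj_span B y + (inner y w / inner w w) *\<^sub>R w"
  have oz: "inner (y - ?p) z = 0" if "z \<in> span B" for z
    using pr(2)[OF that] pr(2)[OF that, of v] unfolding w_def[symmetric] by (simp add: inner_simps)
  have "inner w (proj_span B y) = 0" using pr(2)[OF pr(1)] unfolding w_def by blast
  then have ow: "inner (y - ?p) w = 0"
    by (cases "w = 0") (simp_all add: inner_simps inner_commute)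
  fix z assume "z \<in> span (insert v B)"
  then obtain k where k: "z - k *\<^sub>R v \<in> span B" by (auto simp: span_insert)
  have "z = ((z - k *\<^sub>R v) + k *\<^sub>R proj_span B v) + k *\<^sub>R w" by (simp add: w_def algebra_simps)
  moreover have "(z - k *\<^sub>R v) + k *\<^sub>R proj_span B v \<in> span B"
    using k pr(1) by (intro span_add span_scale)
  ultimately show "inner (y - ?p) z = 0" using oz ow
    by (metis inner_add_right inner_scaleR_right mult_zero_right add_0)
qed (use assms in auto)

lemma proj_energy_insert:
  fixes v y :: "'a::real_inner"
  assumes "finite B"
  defines "w \<equiv> v - proj_span B v"
  shows "proj_energy (insert v B) y = proj_energy B y + (inner y w)\<^sup>2 / inner w w"
proof -
  have "inner (proj_span B y) w = 0"
    using proj_span_orth[OF assms(1) proj_span_in[OF assms(1)]] unfolding w_def by (metis inner_commute)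
  then have "inner (proj_span B y + c *\<^sub>R w) (proj_span B y + c *\<^sub>R w)
    = inner (proj_span B y) (proj_span B y) + c\<^sup>2 * inner w w" for c
    by (simp add: inner_simps inner_commute power2_eq_square)
  then have "proj_energy (insert v B) y = proj_energy B y + (inner y w / inner w w)\<^sup>2 * inner w w"
    by (simp only: proj_energy_def power2_norm_eq_inner proj_span_insert[OF assms(1), of v, folded w_def])
  then show ?thesis by (simp add: power2_eq_square)
qed

lemma proj_residual_norm_mono:
  assumes "finite C" "B \<subseteq> C"
  shows "inner (v - proj_span C v) (v - proj_span C v) \<le> inner (v - proj_span B v) (v - proj_span B v)"
proof -
  have fB: "finite B" using assms finite_subset by blast
  show ?thesis
    using proj_energy_mono[OF assms, of v] 
    by (simp add: proj_energy_eq[OF fB] proj_energy_eq[OF assms(1)] inner_simps inner_commute)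
qed

lemma proj_residual_norm_le:
  assumes "finite B"
  shows "inner (v - proj_span B v) (v - proj_span B v) \<le> inner v v"
  using proj_residual_norm_mono[OF assms, of "{}" v] proj_span_in[of "{}" v] by simp

text \<open>The residual has norm at most 1, so dropping the divisor in
  \<open>proj_energy_insert\<close> only loses. This pays for a pivot that reaches an endpoint,
  where the deficit is half of \<open>(inner y w)\<^sup>2\<close>.\<close>

lemma residual_inner_sq_le_energy_gain:
  fixes v y :: "'a::real_inner"
  assumes "finite B" "norm v \<le> 1"
  defines "w \<equiv> v - proj_span B v"
  shows "proj_energy B y + (inner y w)\<^sup>2 \<le> proj_energy (insert v B) y"
proof (cases "w = 0")
  case True
  then show ?thesis by (simp add: proj_energy_insert[OF assms(1), of v, folded w_def])
next
  case False
  have "inner w w \<le> 1"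
    using proj_residual_norm_le[OF assms(1), of v] assms(2) 
    unfolding w_def[symmetric] by (smt (verit) norm_ge_zero power2_norm_eq_inner power_le_one)
  then have "(inner y w)\<^sup>2 \<le> (inner y w)\<^sup>2 / inner w w"
    using False mult_right_mono[of "inner w w" 1 "(inner y w)\<^sup>2"] by (simp add: field_simps)
  then show ?thesis by (simp add: proj_energy_insert[OF assms(1), of v, folded w_def])
qed

text \<open>The case in which the drift of \<open>y\<close> along the pivot residual changes sign.
  Let p be the projection onto the smaller span and w the residual over \<open>C\<close>. The vector
  p + a w is a valid competitor in the larger span; \<open>inner p w\<close> has the sign of
  \<open>a'\<close>, so the cross term helps, and w of norm at most 1 leaves a gain of a^2.\<close>

lemma energy_drop_opposite:
  fixes v y :: "'a::real_inner"
  assumes "finite C" "B \<subseteq> C" "norm v \<le> 1"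
  defines "a \<equiv> inner y (v - proj_span C v)" and "a' \<equiv> inner y (v - proj_span B v)"
  assumes "a * a' \<le> 0"
  shows "proj_energy (insert v B) y + a\<^sup>2 \<le> proj_energy (insert v C) y"
proof -
  have fB: "finite B" using assms finite_subset by blast
  define w where "w = v - proj_span C v"
  define w' where "w' = v - proj_span B v"
  have BC: "span B \<subseteq> span C" by (rule span_mono) fact
  have ww: "inner w w \<le> 1"
    using proj_residual_norm_le[OF assms(1), of v] assms(3) 
    unfolding w_def[symmetric] by (smt (verit) norm_ge_zero power2_norm_eq_inner power_le_one)
  have o: "inner w z = 0" if "z \<in> span C" for z
    using proj_span_orth[OF assms(1) that] by (simp add: w_def)
  define p where "p = proj_span (insert v B) y"
  have "w' - w \<in> span C"
    using proj_span_in[OF assms(1)] proj_span_in[OF fB] BC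
    unfolding w_def w'_def by (simp add: span_diff subset_iff)
  then have ww': "inner w' w = inner w w" using o[of "w' - w"] by (simp add: inner_simps inner_commute)
  have "inner (proj_span B y) w = 0" using o[of "proj_span B y"] proj_span_in[OF fB] BC
    by (auto simp: inner_commute)
  then have pw: "inner p w = a' / inner w' w' * inner w w"
    by (simp add: p_def proj_span_insert[OF fB, of v y, folded w'_def] inner_simps ww' a'_def w'_def[symmetric])
  have "a * (a' / inner w' w' * inner w w) \<le> 0"
  proof -
    have "a * (a' / inner w' w' * inner w w) = (a * a') * (inner w w / inner w' w')" by simp
    also have "\<dots> \<le> 0" using assms(6) by (rule mult_nonpos_nonneg) auto
    finally show ?thesis .
  qed
  then have apw: "a * inner p w \<le> 0" using pw by simp
  have "p \<in> span (insert v B)" unfolding p_def using fB by (intro proj_span_in) auto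
  then have pin: "p \<in> span (insert v C)" using span_mono[of "insert v B" "insert v C"] assms(2) by auto
  have win: "w \<in> span (insert v C)"
    unfolding w_def using proj_span_in[OF assms(1), of v] span_mono[of C "insert v C"]
    by (intro span_diff) (auto intro: span_base)
  have "2 * inner y (p + a *\<^sub>R w) - inner (p + a *\<^sub>R w) (p + a *\<^sub>R w) \<le> proj_energy (insert v C) y"
    using assms(1) pin win by (intro proj_energy_variational span_add span_scale) auto
  moreover have "proj_energy (insert v B) y = 2 * inner y p - inner p p"
    unfolding p_def using fB by (intro proj_energy_eq) auto
  moreover have "inner y w = a" by (simp add: a_def w_def)
  moreover have "a * a * inner w w \<le> a * a" using ww by (simp add: mult_left_le)
  ultimately show ?thesis using apw by (simp add: inner_simps inner_commute power2_eq_square algebra_simps)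
qed

text \<open>The case in which the drift shrinks. Both energies split off a term drift^2 /
  residual^2. Over \<open>C\<close> the residual is smaller and at most 1, so the difference of the
  quotients is at least the difference of the squares.\<close>

lemma energy_drop_decreasing:
  fixes v y :: "'a::real_inner"
  assumes "finite C" "B \<subseteq> C" "norm v \<le> 1"
  defines "a \<equiv> inner y (v - proj_span C v)" and "a' \<equiv> inner y (v - proj_span B v)"
  assumes "\<bar>a'\<bar> \<le> \<bar>a\<bar>"
  shows "proj_energy (insert v B) y + (a\<^sup>2 - a'\<^sup>2) \<le> proj_energy (insert v C) y"
proof -
  have fB: "finite B" using assms finite_subset by blast
  define r where "r = inner (v - proj_span C v) (v - proj_span C v)"
  define r' where "r' = inner (v - proj_span B v) (v - proj_span B v)"
  have r: "r \<le> r'" unfolding r_def r'_def by (rule proj_residual_norm_mono[OF assms(1,2)])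
  have r1: "r \<le> 1"
    using proj_residual_norm_le[OF assms(1), of v] assms(3) 
    unfolding r_def by (smt (verit) norm_ge_zero power2_norm_eq_inner power_le_one)
  have sq: "a'\<^sup>2 \<le> a\<^sup>2" using assms(6) by (simp add: abs_le_square_iff)
  have "a\<^sup>2 - a'\<^sup>2 \<le> a\<^sup>2 / r - a'\<^sup>2 / r'"
  proof (cases "r = 0")
    case True
    then have "a = 0" by (simp add: r_def a_def)
    then show ?thesis using assms(6) by simp
  next
    case False
    then have rp: "r > 0" by (simp add: r_def order_less_le)
    have "a'\<^sup>2 / r' \<le> a'\<^sup>2 / r" using r rp by (simp add: divide_left_mono)
    moreover have "a\<^sup>2 - a'\<^sup>2 \<le> (a\<^sup>2 - a'\<^sup>2) / r"
      using rp r1 sq mult_left_mono[of r 1 "a\<^sup>2 - a'\<^sup>2"] by (simp add: field_simps)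
    ultimately show ?thesis by (simp add: diff_divide_distrib)
  qed
  moreover have "proj_energy B y \<le> proj_energy C y" by (rule proj_energy_mono[OF assms(1,2)])
  ultimately show ?thesis
    using proj_energy_insert[OF assms(1), of v y] proj_energy_insert[OF fB, of v y]
    by (simp add: a_def a'_def r_def r'_def)
qed

section \<open>The Gram--Schmidt walk\<close>

definition two_point_mgf :: "real \<Rightarrow> real \<Rightarrow> real" where
  "two_point_mgf x a = cosh a + x * sinh a"

text \<open>\<open>two_point_mgf x a\<close> is the expectation of exp (a s) for a random sign s of
  mean \<open>x\<close>. The deficit is the slack in Hoeffding's bound a x + a^2 / 2 for its
  logarithm; at \<open>x\<close> = 1 or -1 the sign is deterministic and the slack is all of a^2 /
  2.\<close>

definition mgf_deficit :: "real \<Rightarrow> real \<Rightarrow> real" where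
  "mgf_deficit x a = a\<^sup>2 / 2 + a * x - ln (two_point_mgf x a)"

lemma two_point_mgf_pos:
  assumes "\<bar>x\<bar> \<le> 1"
  shows "two_point_mgf x a > 0"
proof -
  have "\<bar>x * sinh a\<bar> \<le> \<bar>sinh a\<bar>" using assms by (simp add: abs_mult mult_left_le_one_le)
  moreover have "\<bar>sinh a\<bar> < cosh a"
    by (simp add: abs_real_def sinh_less_cosh_real) (smt (verit) cosh_minus sinh_minus sinh_less_cosh_real)
  ultimately show ?thesis unfolding two_point_mgf_def by linarith
qed

lemma two_point_mgf_minus: "two_point_mgf x (- a) = two_point_mgf (- x) a"
  by (simp add: two_point_mgf_def)

lemma mgf_deficit_minus: "mgf_deficit x (- a) = mgf_deficit (- x) a"
  by (simp add: mgf_deficit_def two_point_mgf_minus)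

text \<open>Write H for the moment function. The derivative \<open>f\<close> of the deficit vanishes
  at 0 and has derivative 1 - (1 - x^2) / H^2, which is nonnegative because H^2 - (1 - x^2) is the
  square of H'. The second quantity has derivative (1 - x^2) sinh a / H.\<close>

lemma mgf_deficit_mono_nonneg:
  assumes x: "\<bar>x\<bar> \<le> 1" and ab: "0 \<le> a" "a \<le> b"
  shows "mgf_deficit x a \<le> mgf_deficit x b"
    and "a\<^sup>2 / 2 - mgf_deficit x a \<le> b\<^sup>2 / 2 - mgf_deficit x b"
proof -
  let ?H = "two_point_mgf x"
  define f where "f a = a - (1 - x\<^sup>2) * sinh a / ?H a" for a
  have Hd: "(?H has_real_derivative sinh a + x * cosh a) (at a)" for a
    unfolding two_point_mgf_def by (auto intro!: derivative_eq_intros)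
  have Hp: "?H a > 0" for a using two_point_mgf_pos[OF x] .
  have key: "a + x - (sinh a + x * cosh a) / ?H a = f a" for a
  proof -
    have "x - (sinh a + x * cosh a) / ?H a = - ((1 - x\<^sup>2) * sinh a / ?H a)"
      using Hp[of a] by (simp add: field_simps two_point_mgf_def power2_eq_square)
    then show ?thesis by (simp add: f_def)
  qed
  have Dd: "(mgf_deficit x has_real_derivative f a) (at a)" for a
  proof -
    have "((\<lambda>a. a\<^sup>2 / 2 + a * x - ln (?H a)) has_real_derivative
        a + x - (inverse (?H a)) * (sinh a + x * cosh a)) (at a)"
      by (rule DERIV_diff[OF _ DERIV_chain2[OF DERIV_ln[OF Hp] Hd]]) (auto intro!: derivative_eq_intros)
    moreover have "a + x - (inverse (?H a)) * (sinh a + x * cosh a) = f a"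
      using key[of a] by (simp add: inverse_eq_divide)
    ultimately show ?thesis unfolding mgf_deficit_def by simp
  qed
  have fd: "(f has_real_derivative 1 - (1 - x\<^sup>2) / (?H a)\<^sup>2) (at a)" for a
  proof -
    have "cosh a * ?H a - sinh a * (sinh a + x * cosh a) = (cosh a)\<^sup>2 - (sinh a)\<^sup>2"
      unfolding two_point_mgf_def by algebra
    also have "\<dots> = 1" by (rule hyperbolic_pythagoras)
    finally have "(1 - x\<^sup>2) * (cosh a * ?H a - sinh a * (sinh a + x * cosh a)) = 1 - x\<^sup>2" by simp
    then have e: "(1 - x\<^sup>2) * cosh a * ?H a - (1 - x\<^sup>2) * sinh a * (sinh a + x * cosh a) = (1 - x\<^sup>2)"
      by (simp only: right_diff_distrib mult.assoc)
    have "((\<lambda>a. (1 - x\<^sup>2) * sinh a) has_real_derivative (1 - x\<^sup>2) * cosh a) (at a)"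
      by (auto intro!: derivative_eq_intros)
    moreover have "?H a \<noteq> 0" using Hp[of a] by simp
    ultimately have "((\<lambda>a. (1 - x\<^sup>2) * sinh a / ?H a) has_real_derivative
      ((1 - x\<^sup>2) * cosh a * ?H a - (1 - x\<^sup>2) * sinh a * (sinh a + x * cosh a)) / (?H a * ?H a)) (at a)"
      using Hd by (intro DERIV_divide)
    from DERIV_diff[OF DERIV_ident this] show ?thesis
      unfolding f_def e power2_eq_square[of "?H a"] .
  qed
  have f0: "f 0 = 0" by (simp add: f_def)
  have "1 - x\<^sup>2 \<le> (?H a)\<^sup>2" for a
  proof -
    have "(cosh a)\<^sup>2 - (sinh a)\<^sup>2 = 1" by (rule hyperbolic_pythagoras)
    then have "(?H a)\<^sup>2 - (1 - x\<^sup>2) = (sinh a + x * cosh a)\<^sup>2"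
      unfolding two_point_mgf_def by algebra
    then show ?thesis by (smt (verit) zero_le_power2)
  qed
  then have fdn: "0 \<le> 1 - (1 - x\<^sup>2) / (?H a)\<^sup>2" for a
    using Hp[of a] by (simp add: field_simps)
  have fn: "0 \<le> f t" if "0 \<le> t" for t
    by (subst f0[symmetric], rule DERIV_nonneg_imp_nondecreasing[OF that]) (blast intro: fd fdn)
  show "mgf_deficit x a \<le> mgf_deficit x b"
    by (rule DERIV_nonneg_imp_nondecreasing[OF ab(2)]) (meson Dd fn ab(1) order_trans)
  have Kd: "((\<lambda>a. a\<^sup>2 / 2 - mgf_deficit x a) has_real_derivative (1 - x\<^sup>2) * sinh a / ?H a) (at a)" for a
  proof -
    have "((\<lambda>a. a\<^sup>2 / 2) has_real_derivative a) (at a)" by (auto intro!: derivative_eq_intros)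
    from DERIV_diff[OF this Dd] show ?thesis by (simp add: f_def)
  qed
  have "x\<^sup>2 \<le> 1" using x by (simp add: abs_square_le_1)
  then have Kn: "0 \<le> (1 - x\<^sup>2) * sinh t / ?H t" if "0 \<le> t" for t
    using Hp[of t] that by auto
  show "a\<^sup>2 / 2 - mgf_deficit x a \<le> b\<^sup>2 / 2 - mgf_deficit x b"
    by (rule DERIV_nonneg_imp_nondecreasing[OF ab(2)]) (use Kd Kn ab(1) order_trans in blast)
qed

lemma mgf_deficit_mono:
  assumes x: "\<bar>x\<bar> \<le> 1" and ab: "0 \<le> a * b" "\<bar>a\<bar> \<le> \<bar>b\<bar>"
  shows "mgf_deficit x a \<le> mgf_deficit x b"
    and "a\<^sup>2 / 2 - mgf_deficit x a \<le> b\<^sup>2 / 2 - mgf_deficit x b"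
proof -
  consider "0 \<le> a" "a \<le> b" | "a \<le> 0" "b \<le> a"
    using ab by (smt (verit) zero_le_mult_iff)
  then have "mgf_deficit x a \<le> mgf_deficit x b
    \<and> a\<^sup>2 / 2 - mgf_deficit x a \<le> b\<^sup>2 / 2 - mgf_deficit x b"
  proof cases
    case 1
    then show ?thesis using mgf_deficit_mono_nonneg[OF x] by blast
  next
    case 2
    then show ?thesis
      using mgf_deficit_mono_nonneg[of "- x" "- a" "- b"] x by (simp add: mgf_deficit_minus[of "-x", simplified])
  qed
  then show "mgf_deficit x a \<le> mgf_deficit x b"
    "a\<^sup>2 / 2 - mgf_deficit x a \<le> b\<^sup>2 / 2 - mgf_deficit x b" by auto
qed

lemma mgf_deficit_bounds:
  assumes "\<bar>x\<bar> \<le> 1"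
  shows mgf_deficit_nonneg: "0 \<le> mgf_deficit x a" and mgf_deficit_le: "mgf_deficit x a \<le> a\<^sup>2 / 2"
proof -
  have "mgf_deficit x 0 = 0" by (simp add: mgf_deficit_def two_point_mgf_def)
  then show "0 \<le> mgf_deficit x a" "mgf_deficit x a \<le> a\<^sup>2 / 2"
    using mgf_deficit_mono[OF assms, of 0 a] by auto
qed

lemma mgf_deficit_endpoint:
  assumes "\<bar>x\<bar> = 1"
  shows "mgf_deficit x a = a\<^sup>2 / 2"
proof -
  have "x = 1 \<or> x = -1" using assms by linarith
  then show ?thesis
    by (auto simp: mgf_deficit_def two_point_mgf_def cosh_plus_sinh cosh_minus_sinh)
qed

text \<open>The potential does not increase when the span loses vectors: either the deficit grows
  with the drift, or the projected energy has dropped enough to compensate.\<close>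

lemma deficit_energy_shrink:
  assumes "finite C" "B \<subseteq> C" "norm v \<le> 1" "\<bar>x\<bar> \<le> 1"
  shows "mgf_deficit x (inner y (v - proj_span C v)) - proj_energy (insert v C) y / 2
    \<le> mgf_deficit x (inner y (v - proj_span B v)) - proj_energy (insert v B) y / 2"
proof -
  define a where "a = inner y (v - proj_span C v)"
  define a' where "a' = inner y (v - proj_span B v)"
  have mono: "proj_energy (insert v B) y \<le> proj_energy (insert v C) y"
    using assms by (intro proj_energy_mono) auto
  \<comment> \<open>The drift reverses, grows or shrinks. On reversal the energy drop alone covers
    the largest possible loss of deficit, a^2 / 2. On growth the deficit is monotone. On shrinking
    the deficit falls by at most half of a^2 - a'^2, which the energy drop covers.\<close>
  consider "a * a' \<le> 0" | "0 \<le> a * a'" "\<bar>a\<bar> \<le> \<bar>a'\<bar>" | "0 \<le> a * a'" "\<bar>a'\<bar> \<le> \<bar>a\<bar>" by linarith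
  then have "mgf_deficit x a - proj_energy (insert v C) y / 2
    \<le> mgf_deficit x a' - proj_energy (insert v B) y / 2"
  proof cases
    case 1
    have "proj_energy (insert v B) y + a\<^sup>2 \<le> proj_energy (insert v C) y"
      using energy_drop_opposite[OF assms(1-3), of y] 1 by (simp add: a_def a'_def)
    then show ?thesis using mgf_deficit_bounds[OF assms(4), of a] mgf_deficit_bounds[OF assms(4), of a'] by linarith
  next
    case 2
    then show ?thesis using mgf_deficit_mono(1)[OF assms(4) 2] mono by linarith
  next
    case 3
    have "proj_energy (insert v B) y + (a\<^sup>2 - a'\<^sup>2) \<le> proj_energy (insert v C) y"
      using energy_drop_decreasing[OF assms(1-3), of y] 3 by (simp add: a_def a'_def)
    moreover have "a'\<^sup>2 / 2 - mgf_deficit x a' \<le> a\<^sup>2 / 2 - mgf_deficit x a"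
      using mgf_deficit_mono(2)[OF assms(4), of a' a] 3 by (simp add: mult.commute)
    ultimately show ?thesis by linarith
  qed
  then show ?thesis by (simp add: a_def a'_def)
qed


section \<open>The walk inside the cube\<close>

lemma span_image_finite_sum:
  assumes "finite B" "y \<in> span (v ` B)"
  shows "\<exists>c. y = (\<Sum>i\<in>B. c i *\<^sub>R v i)"
  using assms
proof (induction B arbitrary: y rule: finite_induct)
  case empty
  then show ?case by simp
next
  case (insert b B)
  then obtain k where "y - k *\<^sub>R v b \<in> span (v ` B)" by (auto simp: span_insert)
  then obtain c where c: "y - k *\<^sub>R v b = (\<Sum>i\<in>B. c i *\<^sub>R v i)" using insert.IH by blast
  have "(\<Sum>i\<in>B. (if i = b then k else c i) *\<^sub>R v i) = (\<Sum>i\<in>B. c i *\<^sub>R v i)"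
    using insert.hyps by (intro sum.cong) auto
  then have "y = (\<Sum>i\<in>insert b B. (if i = b then k else c i) *\<^sub>R v i)"
    using c insert.hyps by (simp add: algebra_simps)
  then show ?case by (intro exI[of _ "\<lambda>i. if i = b then k else c i"])
qed

lemma step_to_cube_boundary:
  fixes x u :: "'i \<Rightarrow> real"
  assumes "finite A" "p \<in> A" "u p \<noteq> 0" "\<forall>i\<in>A. \<bar>x i\<bar> < 1"
  shows "\<exists>t>0. (\<forall>i\<in>A. \<bar>x i + t * u i\<bar> \<le> 1) \<and> (\<exists>i\<in>A. \<bar>x i + t * u i\<bar> = 1)"
proof -
  \<comment> \<open>The time at which coordinate \<open>i\<close>, moving with velocity
    \<open>u i\<close>, reaches the face it is heading for; the step length is the first such
    time.\<close>
  define r where "r i = (1 - sgn (u i) * x i) / \<bar>u i\<bar>" for i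
  define A' where "A' = {i\<in>A. u i \<noteq> 0}"
  have A': "finite A'" "A' \<noteq> {}" using assms by (auto simp: A'_def)
  define t where "t = Min (r ` A')"
  have rpos: "r i > 0" if "i \<in> A'" for i
  proof -
    have "u i \<noteq> 0" "\<bar>x i\<bar> < 1" using that assms(4) by (auto simp: A'_def)
    then show ?thesis unfolding r_def sgn_real_def by (intro divide_pos_pos) auto
  qed
  have "t \<in> r ` A'" unfolding t_def using A' by (intro Min_in) auto
  then obtain j where j: "j \<in> A'" "t = r j" by blast
  have tp: "t > 0" using rpos j by simp
  have tle: "t \<le> r i" if "i \<in> A'" for i unfolding t_def using A' that by (intro Min_le) auto
  have "\<bar>x i + t * u i\<bar> \<le> 1" if i: "i \<in> A" for i
  proof (cases "u i = 0")
    case True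
    then show ?thesis using assms(4) i by (auto intro: less_imp_le)
  next
    case False
    then have "t \<le> r i" using tle i by (auto simp: A'_def)
    then have "t * \<bar>u i\<bar> \<le> 1 - sgn (u i) * x i" using False by (simp add: r_def field_simps)
    moreover have "0 \<le> t * \<bar>u i\<bar>" using tp by simp
    moreover have "\<bar>x i\<bar> < 1" using assms(4) i by simp
    ultimately show ?thesis using False by (cases "u i > 0") auto
  qed
  moreover have "\<bar>x j + t * u j\<bar> = 1"
  proof -
    have "u j \<noteq> 0" using j by (auto simp: A'_def)
    then show ?thesis unfolding j(2) r_def by (cases "u j > 0") (auto simp: field_simps)
  qed
  ultimately show ?thesis using tp j by (auto simp: A'_def)
qed

lemma exp_minus_deficit:
  assumes "\<bar>x\<bar> \<le> 1"
  shows "exp (- mgf_deficit x a) = exp (- (a\<^sup>2 / 2) - a * x) * two_point_mgf x a"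
proof -
  have "- mgf_deficit x a = (- (a\<^sup>2 / 2) - a * x) + ln (two_point_mgf x a)"
    by (simp add: mgf_deficit_def)
  then show ?thesis
    using two_point_mgf_pos[OF assms, of a] by (simp only: exp_add exp_ln)
qed

text \<open>A derandomised Gram--Schmidt walk with pivot p. Along the update direction the potential
  of each test vector is an affine function of the step length, so one of the two signs of the step
  does not increase the total potential.\<close>

lemma gram_schmidt_walk:
  fixes v :: "'i \<Rightarrow> 'a::real_inner"
  assumes S: "finite S" and v: "\<And>i. i \<in> S \<Longrightarrow> norm (v i) \<le> 1"
  shows "\<lbrakk>A \<subseteq> S; p \<in> A; \<forall>i\<in>A. \<bar>x i\<bar> < 1; \<forall>i\<in>S - A. \<bar>x i\<bar> = 1\<rbrakk> \<Longrightarrow>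
    \<exists>\<epsilon>. (\<forall>i\<in>S. \<bar>\<epsilon> i\<bar> = (1::real)) \<and>
      (\<Sum>y\<in>F. exp (inner y (\<Sum>i\<in>S. \<epsilon> i *\<^sub>R v i)))
      \<le> (\<Sum>y\<in>F. exp (inner y (\<Sum>i\<in>S. x i *\<^sub>R v i)
            - mgf_deficit (x p) (inner y (v p - proj_span (v ` (A - {p})) (v p)))
            + proj_energy (v ` A) y / 2))"
proof (induction "card A" arbitrary: A p x rule: less_induct)
  case less
  define Y where "Y x = (\<Sum>i\<in>S. x i *\<^sub>R v i)" for x :: "'i \<Rightarrow> real"
  define w where "w = v p - proj_span (v ` (A - {p})) (v p)"
  have fA: "finite A" using less.prems S finite_subset by blast
  have pS: "p \<in> S" using less.prems by blast
  have vA: "v ` A = insert (v p) (v ` (A - {p}))" using less.prems by auto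
  define pot where "pot x = (\<Sum>y\<in>F. exp (inner y (Y x) - mgf_deficit (x p) (inner y w) + proj_energy (v ` A) y / 2))" for x
  obtain c where c: "proj_span (v ` (A - {p})) (v p) = (\<Sum>i\<in>A - {p}. c i *\<^sub>R v i)"
    using span_image_finite_sum[of "A - {p}"] proj_span_in[of "v ` (A - {p})"] fA by blast
  \<comment> \<open>Moving the pivot at unit speed, the other undecided coordinates compensate as
    much as possible: the vector sum moves along \<open>w\<close>, orthogonal to their span.\<close>
  define u where "u i = (if i = p then 1 else if i \<in> A then - c i else 0)" for i
  have "(\<Sum>i\<in>S. u i *\<^sub>R v i) = (\<Sum>i\<in>A. u i *\<^sub>R v i)"
    using less.prems S by (intro sum.mono_neutral_right) (auto simp: u_def)
  also have "\<dots> = v p + (\<Sum>i\<in>A - {p}. u i *\<^sub>R v i)"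
    using less.prems fA by (simp add: sum.remove[of A p] u_def)
  also have "(\<Sum>i\<in>A - {p}. u i *\<^sub>R v i) = (\<Sum>i\<in>A - {p}. - (c i *\<^sub>R v i))"
    by (intro sum.cong) (auto simp: u_def)
  finally have "(\<Sum>i\<in>S. u i *\<^sub>R v i) = w" by (simp add: w_def c sum_negf)
  then have uw: "(\<Sum>i\<in>S. t *\<^sub>R u i *\<^sub>R v i) = t *\<^sub>R w" for t
    by (metis scaleR_sum_right)
  have Yu: "Y (\<lambda>i. x i + t * u i) = Y x + t *\<^sub>R w" for t
    unfolding Y_def uw[symmetric] by (simp add: scaleR_add_left sum.distrib)
  \<comment> \<open>The part of the potential of \<open>y\<close> that is free of the step length t.
    The term a x in the deficit cancels the factor exp (t a) coming from the move, and only the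
    moment function remains, which is affine in its mean.\<close>
  define K where "K y = exp (inner y (Y x) - (inner y w)\<^sup>2 / 2 - inner y w * x p + proj_energy (v ` A) y / 2)" for y
  have pot: "pot (\<lambda>i. x i + t * u i) = (\<Sum>y\<in>F. K y * two_point_mgf (x p) (inner y w)) + t * (\<Sum>y\<in>F. K y * sinh (inner y w))"
    if "\<bar>x p + t\<bar> \<le> 1" for t
  proof -
    have "exp (inner y (Y x + t *\<^sub>R w) - mgf_deficit (x p + t) (inner y w) + proj_energy (v ` A) y / 2)
      = K y * two_point_mgf (x p) (inner y w) + t * (K y * sinh (inner y w))" for y
    proof -
      have "exp (inner y (Y x + t *\<^sub>R w) - mgf_deficit (x p + t) (inner y w) + proj_energy (v ` A) y / 2)
        = exp (inner y (Y x + t *\<^sub>R w) + proj_energy (v ` A) y / 2) * exp (- mgf_deficit (x p + t) (inner y w))"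
        by (simp flip: exp_add)
      also have "\<dots> = K y * two_point_mgf (x p + t) (inner y w)"
        unfolding exp_minus_deficit[OF that] K_def mult.assoc[symmetric]
        by (simp add: inner_simps algebra_simps flip: exp_add)
      finally show ?thesis by (simp add: two_point_mgf_def algebra_simps)
    qed
    then show ?thesis unfolding pot_def Yu by (simp add: u_def sum.distrib sum_distrib_left)
  qed
  have xS: "\<bar>x i\<bar> \<le> 1" if "i \<in> S" for i using that less.prems by (cases "i \<in> A") (auto intro: less_imp_le)
  have pot0: "pot x = (\<Sum>y\<in>F. K y * two_point_mgf (x p) (inner y w))"
    using pot[of 0] xS[OF pS] by simp
  have "\<exists>t. (\<forall>i\<in>A. \<bar>x i + t * u i\<bar> \<le> 1) \<and> (\<exists>i\<in>A. \<bar>x i + t * u i\<bar> = 1)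
      \<and> t * (\<Sum>y\<in>F. K y * sinh (inner y w)) \<le> 0"
  proof (cases "(\<Sum>y\<in>F. K y * sinh (inner y w)) \<le> 0")
    case True
    obtain t where "t > 0" "\<forall>i\<in>A. \<bar>x i + t * u i\<bar> \<le> 1" "\<exists>i\<in>A. \<bar>x i + t * u i\<bar> = 1"
      using step_to_cube_boundary[OF fA less.prems(2), of u x] less.prems(3) by (auto simp: u_def)
    with True show ?thesis by (intro exI[of _ t]) (simp add: mult_nonneg_nonpos)
  next
    case False
    obtain t where "t > 0" "\<forall>i\<in>A. \<bar>x i + t * (- u i)\<bar> \<le> 1" "\<exists>i\<in>A. \<bar>x i + t * (- u i)\<bar> = 1"
      using step_to_cube_boundary[OF fA less.prems(2), of "\<lambda>i. - u i" x] less.prems(3) by (auto simp: u_def)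
    with False show ?thesis by (intro exI[of _ "- t"]) simp
  qed
  then obtain t where t: "\<forall>i\<in>A. \<bar>x i + t * u i\<bar> \<le> 1" "\<exists>i\<in>A. \<bar>x i + t * u i\<bar> = 1"
    "t * (\<Sum>y\<in>F. K y * sinh (inner y w)) \<le> 0" by blast
  define x' where "x' i = x i + t * u i" for i
  have pot_le: "pot x' \<le> pot x"
    using pot[of t] t less.prems(2) unfolding pot0 x'_def by (auto simp: u_def)
  define A' where "A' = {i\<in>A. \<bar>x' i\<bar> < 1}"
  have A'A: "A' \<subset> A" using t(2) unfolding A'_def x'_def by (auto dest!: equalityD2)
  then have card': "card A' < card A" using fA psubset_card_mono by blast
  have A'S: "A' \<subseteq> S" using A'A less.prems by auto
  have x'A: "\<forall>i\<in>A'. \<bar>x' i\<bar> < 1" by (auto simp: A'_def)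
  have x'S: "\<forall>i\<in>S - A'. \<bar>x' i\<bar> = 1"
  proof
    fix i assume i: "i \<in> S - A'"
    show "\<bar>x' i\<bar> = 1"
    proof (cases "i \<in> A")
      case True
      then show ?thesis using i t(1) by (auto simp: A'_def x'_def)
    next
      case False
      then show ?thesis using i less.prems by (auto simp: x'_def u_def)
    qed
  qed
  have x'p: "\<bar>x' p\<bar> \<le> 1" using t(1) less.prems by (auto simp: x'_def)
  define goal_bound where "goal_bound B \<longleftrightarrow> (\<exists>\<epsilon>. (\<forall>i\<in>S. \<bar>\<epsilon> i\<bar> = (1::real))
      \<and> (\<Sum>y\<in>F. exp (inner y (Y \<epsilon>))) \<le> B)" for B
  have IH: "goal_bound (\<Sum>y\<in>F. exp (inner y (Y x')
            - mgf_deficit (x' q) (inner y (v q - proj_span (v ` (A' - {q})) (v q)))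
            + proj_energy (v ` A') y / 2))" if "q \<in> A'" for q
    unfolding goal_bound_def Y_def by (rule less.hyps[OF card' A'S that x'A x'S])
  have mono: "goal_bound B'" if "goal_bound B" "B \<le> B'" for B B'
    using that unfolding goal_bound_def by fastforce
  have "goal_bound (pot x')"
  proof (cases "p \<in> A'")
    case True
    \<comment> \<open>The pivot is still undecided and stays the pivot. Frozen indices only shrink
      the span, so \<open>deficit_energy_shrink\<close> applies.\<close>
    have "mgf_deficit (x' p) (inner y w) - proj_energy (v ` A) y / 2
      \<le> mgf_deficit (x' p) (inner y (v p - proj_span (v ` (A' - {p})) (v p))) - proj_energy (v ` A') y / 2" for y
    proof -
      have "v ` A' = insert (v p) (v ` (A' - {p}))" using True by auto
      then show ?thesis
        using deficit_energy_shrink[of "v ` (A - {p})" "v ` (A' - {p})" "v p" "x' p" y] fA A'A x'p v[OF pS]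
        unfolding vA w_def by auto
    qed
    then show ?thesis
      by (intro mono[OF IH[OF True]]) (auto simp: pot_def intro!: sum_mono simp: algebra_simps)
  next
    case False
    \<comment> \<open>The pivot froze, so its deficit has the full value a^2 / 2. The energy lost
      with \<open>v p\<close> is at least a^2, so the potential without any deficit term is no
      larger.\<close>
    then have p1: "\<bar>x' p\<bar> = 1" using x'S pS by auto
    have sub: "v ` A' \<subseteq> v ` (A - {p})" using False A'A by auto
    have pl: "(\<Sum>y\<in>F. exp (inner y (Y x') + proj_energy (v ` A') y / 2)) \<le> pot x'"
      unfolding pot_def
    proof (intro sum_mono)
      fix y
      have "proj_energy (v ` (A - {p})) y + (inner y w)\<^sup>2 \<le> proj_energy (v ` A) y"
        unfolding vA w_def using fA v[OF pS] by (intro residual_inner_sq_le_energy_gain) auto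
      moreover have "proj_energy (v ` A') y \<le> proj_energy (v ` (A - {p})) y"
        using sub fA by (intro proj_energy_mono) auto
      ultimately show "exp (inner y (Y x') + proj_energy (v ` A') y / 2)
        \<le> exp (inner y (Y x') - mgf_deficit (x' p) (inner y w) + proj_energy (v ` A) y / 2)"
        by (simp add: mgf_deficit_endpoint[OF p1])
    qed
    show ?thesis
    proof (cases "A' = {}")
      case True
      have "goal_bound (\<Sum>y\<in>F. exp (inner y (Y x')))"
        unfolding goal_bound_def using x'S True by (intro exI[of _ x']) auto
      moreover have "(\<Sum>y\<in>F. exp (inner y (Y x'))) \<le> (\<Sum>y\<in>F. exp (inner y (Y x') + proj_energy (v ` A') y / 2))"
        by (intro sum_mono) (simp add: proj_energy_def)
      ultimately show ?thesis using mono pl by (meson order_trans)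
    next
      case nonempty: False
      \<comment> \<open>Any undecided index can be the next pivot: its deficit is nonnegative and
        enters with a minus sign.\<close>
      then obtain q where q: "q \<in> A'" by blast
      then have "\<bar>x' q\<bar> \<le> 1" using x'A by (auto intro: less_imp_le)
      then show ?thesis
        by (intro mono[OF IH[OF q] order_trans[OF _ pl]] sum_mono) (simp add: mgf_deficit_nonneg)
    qed
  qed
  from mono[OF this pot_le] show ?case
    unfolding goal_bound_def pot_def Y_def w_def by simp
qed

text \<open>The walk starts at the centre of the cube with every vector undecided. The bound is what
  random signs with subgaussian constant 1 would give in expectation, here achieved by one signing
  for the whole sum over \<open>F\<close>.\<close>

lemma subgaussian_balancing:
  fixes v :: "'i \<Rightarrow> 'a::real_inner"
  assumes S: "finite S" and v: "\<And>i. i \<in> S \<Longrightarrow> norm (v i) \<le> 1"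
  shows "\<exists>\<epsilon>. (\<forall>i\<in>S. \<bar>\<epsilon> i\<bar> = (1::real)) \<and>
      (\<Sum>y\<in>F. exp (inner y (\<Sum>i\<in>S. \<epsilon> i *\<^sub>R v i))) \<le> (\<Sum>y\<in>F. exp ((norm y)\<^sup>2 / 2))"
proof (cases "S = {}")
  case True
  then show ?thesis by (intro exI[of _ "\<lambda>_. 1"]) (simp add: sum_mono del: sum_constant)
next
  case False
  then obtain p where p: "p \<in> S" by blast
  obtain \<epsilon> where \<epsilon>: "\<forall>i\<in>S. \<bar>\<epsilon> i\<bar> = (1::real)"
      "(\<Sum>y\<in>F. exp (inner y (\<Sum>i\<in>S. \<epsilon> i *\<^sub>R v i)))
      \<le> (\<Sum>y\<in>F. exp (- mgf_deficit 0 (inner y (v p - proj_span (v ` (S - {p})) (v p)))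
            + proj_energy (v ` S) y / 2))"
    using gram_schmidt_walk[where v = v and S = S and A = S and p = p and F = F and x = "\<lambda>_. 0", OF S v] p by auto
  note \<epsilon>(2)
  also have "(\<Sum>y\<in>F. exp (- mgf_deficit 0 (inner y (v p - proj_span (v ` (S - {p})) (v p)))
            + proj_energy (v ` S) y / 2)) \<le> (\<Sum>y\<in>F. exp ((norm y)\<^sup>2 / 2))"
  proof (intro sum_mono)
    fix y
    show "exp (- mgf_deficit 0 (inner y (v p - proj_span (v ` (S - {p})) (v p))) + proj_energy (v ` S) y / 2)
      \<le> exp ((norm y)\<^sup>2 / 2)"
      using mgf_deficit_nonneg[of 0 "inner y (v p - proj_span (v ` (S - {p})) (v p))"]
        proj_energy_le_norm[of "v ` S" y] S by simp
  qed
  finally show ?thesis using \<epsilon>(1) by blast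
qed

section \<open>Discrepancy through weighted blocks\<close>

text \<open>Finitely supported functions form an inner product space over any index type, so blocks
  can serve as coordinates although their number varies with the grid.\<close>

typedef 'k fin_vec = "{f :: 'k \<Rightarrow> real. finite {k. f k \<noteq> 0}}"
  by (rule exI[of _ "\<lambda>_. 0"]) simp

setup_lifting type_definition_fin_vec

instantiation fin_vec :: (type) real_vector
begin

lift_definition zero_fin_vec :: "'a fin_vec" is "\<lambda>_. 0" by simp

lift_definition plus_fin_vec :: "'a fin_vec \<Rightarrow> 'a fin_vec \<Rightarrow> 'a fin_vec"
  is "\<lambda>f g k. f k + g k"
  subgoal for f g by (rule finite_subset[of _ "{k. f k \<noteq> 0} \<union> {k. g k \<noteq> 0}"]) auto
  done

lift_definition uminus_fin_vec :: "'a fin_vec \<Rightarrow> 'a fin_vec" is "\<lambda>f k. - f k" by simp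

lift_definition minus_fin_vec :: "'a fin_vec \<Rightarrow> 'a fin_vec \<Rightarrow> 'a fin_vec"
  is "\<lambda>f g k. f k - g k"
  subgoal for f g by (rule finite_subset[of _ "{k. f k \<noteq> 0} \<union> {k. g k \<noteq> 0}"]) auto
  done

lift_definition scaleR_fin_vec :: "real \<Rightarrow> 'a fin_vec \<Rightarrow> 'a fin_vec" is "\<lambda>c f k. c * f k"
  by (erule finite_subset[rotated]) auto

instance
  by standard (transfer; simp add: algebra_simps fun_eq_iff)+

end

lift_definition fin_vec_nth :: "'k fin_vec \<Rightarrow> 'k \<Rightarrow> real" is "\<lambda>f. f" .

lemma finite_support_fin_vec: "finite {k. fin_vec_nth x k \<noteq> 0}"
  by transfer

lemma fin_vec_nth_simps [simp]:
  "fin_vec_nth 0 k = 0"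
  "fin_vec_nth (x + y) k = fin_vec_nth x k + fin_vec_nth y k"
  "fin_vec_nth (c *\<^sub>R x) k = c * fin_vec_nth x k"
  by (transfer; simp)+

lemma fin_vec_eq_iff: "x = y \<longleftrightarrow> (\<forall>k. fin_vec_nth x k = fin_vec_nth y k)"
  by transfer auto

instantiation fin_vec :: (type) real_inner
begin

definition inner_fin_vec :: "'a fin_vec \<Rightarrow> 'a fin_vec \<Rightarrow> real" where
  "inner_fin_vec x y = (\<Sum>k | fin_vec_nth x k \<noteq> 0. fin_vec_nth x k * fin_vec_nth y k)"
definition norm_fin_vec :: "'a fin_vec \<Rightarrow> real" where
  "norm_fin_vec x = sqrt (inner x x)"
definition dist_fin_vec :: "'a fin_vec \<Rightarrow> 'a fin_vec \<Rightarrow> real" where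
  "dist_fin_vec x y = norm (x - y)"
definition sgn_fin_vec :: "'a fin_vec \<Rightarrow> 'a fin_vec" where
  "sgn_fin_vec x = x /\<^sub>R norm x"
definition uniformity_fin_vec :: "('a fin_vec \<times> 'a fin_vec) filter" where
  "uniformity_fin_vec = (INF e\<in>{0<..}. principal {(x, y). dist x y < e})"
definition open_fin_vec :: "'a fin_vec set \<Rightarrow> bool" where
  "open_fin_vec U \<longleftrightarrow> (\<forall>x\<in>U. eventually (\<lambda>(x', y). x' = x \<longrightarrow> y \<in> U) uniformity)"

lemma inner_fin_vec_superset:
  assumes "finite K" "{k. fin_vec_nth x k \<noteq> 0} \<subseteq> K"
  shows "inner x y = (\<Sum>k\<in>K. fin_vec_nth x k * fin_vec_nth y k)"
  unfolding inner_fin_vec_def using assms by (intro sum.mono_neutral_left) auto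

instance
proof
  fix x y z :: "'a fin_vec" and r :: real
  define K where "K = {k. fin_vec_nth x k \<noteq> 0} \<union> {k. fin_vec_nth y k \<noteq> 0}"
  have K: "finite K" "{k. fin_vec_nth x k \<noteq> 0} \<subseteq> K" "{k. fin_vec_nth y k \<noteq> 0} \<subseteq> K"
    "{k. fin_vec_nth (x + y) k \<noteq> 0} \<subseteq> K" "{k. fin_vec_nth (r *\<^sub>R x) k \<noteq> 0} \<subseteq> K"
    by (auto simp: K_def finite_support_fin_vec)
  note sup = inner_fin_vec_superset[OF K(1)]
  show "inner x y = inner y x"
    by (simp add: sup K mult.commute)
  show "inner (x + y) z = inner x z + inner y z"
    by (simp add: sup[OF K(2)] sup[OF K(3)] sup[OF K(4)] sum.distrib algebra_simps)
  show "inner (r *\<^sub>R x) y = r * inner x y"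
    by (simp add: sup[OF K(2)] sup[OF K(5)] sum_distrib_left algebra_simps)
  show "0 \<le> inner x x" by (simp add: inner_fin_vec_def sum_nonneg)
  show "inner x x = 0 \<longleftrightarrow> x = 0"
    by (auto simp: inner_fin_vec_def sum_nonneg_eq_0_iff finite_support_fin_vec fin_vec_eq_iff)
  show "norm x = sqrt (inner x x)" by (rule norm_fin_vec_def)
qed (fact dist_fin_vec_def sgn_fin_vec_def uniformity_fin_vec_def open_fin_vec_def)+

end

lift_definition fin_vec_of :: "'k set \<Rightarrow> ('k \<Rightarrow> real) \<Rightarrow> 'k fin_vec"
  is "\<lambda>K f k. if finite K \<and> k \<in> K then f k else 0"
  subgoal for K by (cases "finite K") auto
  done

lemma inner_fin_vec_of:
  assumes "finite K"
  shows "inner (fin_vec_of K f) (fin_vec_of K g) = (\<Sum>k\<in>K. f k * g k)"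
proof -
  have nth: "fin_vec_nth (fin_vec_of K h) k = (if k \<in> K then h k else 0)" for h k
    using assms by transfer simp
  show ?thesis
    using assms by (subst inner_fin_vec_superset[of K]) (auto simp: nth split: if_splits)
qed

text \<open>Factor the incidence structure through the blocks, weighting the coordinate of a block k by
  the square root of its weight on the side of the points and by its inverse on the side of the
  sets.\<close>

lemma discrepancy_via_blocks:
  fixes \<Omega> :: "'a set" and K :: "'k set" and block :: "'k \<Rightarrow> 'a set" and \<tau> :: "'k \<Rightarrow> real"
    and part :: "'a set \<Rightarrow> 'k set"
  assumes fin: "finite \<Omega>" "finite K" "finite F" "F \<noteq> {}"
    and pos: "\<And>k. k \<in> K \<Longrightarrow> \<tau> k > 0" "T > 0" "R > 0"
    and T: "\<And>x. x \<in> \<Omega> \<Longrightarrow> (\<Sum>k | k \<in> K \<and> x \<in> block k. \<tau> k) \<le> T"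
    and part: "\<And>A. A \<in> F \<Longrightarrow> A \<subseteq> \<Omega> \<and> part A \<subseteq> K"
    and dec: "\<And>A x. A \<in> F \<Longrightarrow> x \<in> \<Omega> \<Longrightarrow>
      (\<Sum>k\<in>part A. indicator (block k) x) = (indicator A x :: real)"
    and R: "\<And>A. A \<in> F \<Longrightarrow> (\<Sum>k\<in>part A. 1 / \<tau> k) \<le> R"
  shows "\<exists>\<epsilon>. (\<forall>x\<in>\<Omega>. \<bar>\<epsilon> x\<bar> = (1::real)) \<and>
    (\<forall>A\<in>F. \<bar>\<Sum>x\<in>A. \<epsilon> x\<bar> \<le> sqrt (T * R) * sqrt (2 * ln (2 * real (card F))))"
proof -
  define n where "n = real (card F)"
  have n: "n \<ge> 1" using fin unfolding n_def
    by (metis One_nat_def Suc_leI card_gt_0_iff of_nat_1 of_nat_le_iff)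
  define \<Lambda> where "\<Lambda> = sqrt (2 * ln (2 * n))"
  have L0: "\<Lambda> > 0" using n unfolding \<Lambda>_def by simp
  have L2: "\<Lambda>\<^sup>2 = 2 * ln (2 * n)" using n unfolding \<Lambda>_def by simp
  define v where "v x = fin_vec_of K (\<lambda>k. sqrt (\<tau> k / T) * indicator (block k) x)" for x
  define th where "th A = fin_vec_of K (\<lambda>k. if k \<in> part A then sqrt (T / \<tau> k) else 0)" for A
  have nv: "norm (v x) \<le> 1" if "x \<in> \<Omega>" for x
  proof -
    have "inner (v x) (v x) = (\<Sum>k\<in>K. (\<tau> k / T) * indicator (block k) x)"
      unfolding v_def inner_fin_vec_of[OF fin(2)] using pos
      by (intro sum.cong) (auto simp: indicator_def power2_eq_square[symmetric] less_imp_le)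
    also have "\<dots> = (\<Sum>k | k \<in> K \<and> x \<in> block k. \<tau> k) / T"
      unfolding sum_divide_distrib using fin
      by (intro sum.mono_neutral_cong_right) (auto simp: indicator_def)
    also have "\<dots> \<le> 1" using T[OF that] pos by simp
    finally show ?thesis by (simp add: norm_eq_sqrt_inner)
  qed
  have thv: "inner (th A) (v x) = indicator A x" if "A \<in> F" "x \<in> \<Omega>" for A x
  proof -
    have "inner (th A) (v x) = (\<Sum>k\<in>K. if k \<in> part A then indicator (block k) x else 0)"
      unfolding v_def th_def inner_fin_vec_of[OF fin(2)] using pos
      by (intro sum.cong) (auto simp: real_sqrt_divide order_less_le)
    also have "\<dots> = (\<Sum>k\<in>part A. indicator (block k) x)"
      using part[OF that(1)] fin by (simp add: sum.inter_restrict[symmetric] Int_absorb1)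
    finally show ?thesis using dec that by simp
  qed
  have nth: "(norm (th A))\<^sup>2 \<le> T * R" if "A \<in> F" for A
  proof -
    have "inner (th A) (th A) = (\<Sum>k\<in>K. if k \<in> part A then T * (1 / \<tau> k) else 0)"
      unfolding th_def inner_fin_vec_of[OF fin(2)] using pos
      by (intro sum.cong) (auto simp: power2_eq_square[symmetric] less_imp_le)
    also have "\<dots> = T * (\<Sum>k\<in>part A. 1 / \<tau> k)"
      using part[OF that] fin by (simp add: sum.inter_restrict[symmetric] Int_absorb1 sum_distrib_left)
    also have "\<dots> \<le> T * R" using R[OF that] pos by simp
    finally show ?thesis by (simp add: power2_norm_eq_inner)
  qed
  \<comment> \<open>This scale makes every test vector have squared norm at most
    \<open>\<Lambda>\<^sup>2\<close>, that is 2 ln (2n). The right side of the balancing bound is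
    then at most 2n terms of size at most 2n, in total \<open>exp (\<Lambda>\<^sup>2)\<close>, so
    every single exponent is at most \<open>\<Lambda>\<^sup>2\<close>. Both signs are put into
    \<open>G\<close> to control absolute values.\<close>
  define s where "s = \<Lambda> / sqrt (T * R)"
  have TR: "T * R > 0" using pos by simp
  have s0: "s > 0" using L0 TR by (simp add: s_def)
  have s2: "s\<^sup>2 * (T * R) = \<Lambda>\<^sup>2" using TR pos by (simp add: s_def power_divide)
  define G where "G = (\<lambda>A. s *\<^sub>R th A) ` F \<union> (\<lambda>A. - (s *\<^sub>R th A)) ` F"
  have fG: "finite G" using fin by (simp add: G_def)
  have cG: "real (card G) \<le> 2 * n"
    using card_Un_le[of "(\<lambda>A. s *\<^sub>R th A) ` F" "(\<lambda>A. - (s *\<^sub>R th A)) ` F"]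
      card_image_le[OF fin(3), of "\<lambda>A. s *\<^sub>R th A"] card_image_le[OF fin(3), of "\<lambda>A. - (s *\<^sub>R th A)"]
    unfolding G_def n_def by linarith
  have gG: "exp ((norm g)\<^sup>2 / 2) \<le> 2 * n" if "g \<in> G" for g
  proof -
    obtain A where A: "A \<in> F" "norm g = s * norm (th A)"
      using \<open>g \<in> G\<close> s0 unfolding G_def by auto
    have "(norm g)\<^sup>2 \<le> s\<^sup>2 * (T * R)"
      unfolding A(2) power_mult_distrib using nth[OF A(1)] by (intro mult_left_mono) auto
    then have "(norm g)\<^sup>2 / 2 \<le> ln (2 * n)" unfolding s2 L2 by simp
    then show ?thesis using n by (metis exp_le_cancel_iff exp_ln less_le_trans mult_pos_pos zero_less_numeral zero_less_one)
  qed
  obtain \<epsilon> where e: "\<forall>x\<in>\<Omega>. \<bar>\<epsilon> x\<bar> = (1::real)"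
    "(\<Sum>g\<in>G. exp (inner g (\<Sum>x\<in>\<Omega>. \<epsilon> x *\<^sub>R v x))) \<le> (\<Sum>g\<in>G. exp ((norm g)\<^sup>2 / 2))"
    using subgaussian_balancing[where S = \<Omega> and v = v and F = G] fin(1) nv by auto
  define z where "z = (\<Sum>x\<in>\<Omega>. \<epsilon> x *\<^sub>R v x)"
  have "(\<Sum>g\<in>G. exp ((norm g)\<^sup>2 / 2)) \<le> real (card G) * (2 * n)"
    using sum_bounded_above[of G "\<lambda>g. exp ((norm g)\<^sup>2 / 2)" "2 * n"] gG by simp
  also have "\<dots> \<le> (2 * n)\<^sup>2" using cG n by (simp add: power2_eq_square mult_right_mono)
  also have "\<dots> = exp (\<Lambda>\<^sup>2)" using n unfolding L2 by (simp add: exp_double)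
  finally have tot: "(\<Sum>g\<in>G. exp (inner g z)) \<le> exp (\<Lambda>\<^sup>2)" using e(2) unfolding z_def by linarith
  have zle: "inner g z \<le> \<Lambda>\<^sup>2" if "g \<in> G" for g
  proof -
    have "exp (inner g z) \<le> (\<Sum>g\<in>G. exp (inner g z))"
      using that fG by (intro member_le_sum) auto
    then show ?thesis using tot by (meson exp_le_cancel_iff order_trans)
  qed
  have b: "s * \<bar>inner (th A) z\<bar> \<le> \<Lambda>\<^sup>2" if "A \<in> F" for A
    using that s0 zle[of "s *\<^sub>R th A"] zle[of "- (s *\<^sub>R th A)"] by (auto simp: G_def abs_real_def)
  have "inner (th A) z = (\<Sum>x\<in>A. \<epsilon> x)" if "A \<in> F" for A
  proof -
    have "inner (th A) z = (\<Sum>x\<in>\<Omega>. \<epsilon> x * indicator A x)"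
      unfolding z_def inner_sum_right using thv[OF that] by (intro sum.cong) auto
    also have "\<dots> = (\<Sum>x\<in>A. \<epsilon> x)"
      using part[OF that] fin by (intro sum.mono_neutral_cong_right) (auto simp: indicator_def)
    finally show ?thesis .
  qed
  moreover have "\<Lambda>\<^sup>2 / s = sqrt (T * R) * \<Lambda>"
    using L0 by (simp add: s_def power2_eq_square)
  ultimately have "\<bar>\<Sum>x\<in>A. \<epsilon> x\<bar> \<le> sqrt (T * R) * \<Lambda>" if "A \<in> F" for A
    using b[OF that] that s0 by (simp add: field_simps)
  then show ?thesis using e(1) unfolding \<Lambda>_def n_def by blast
qed

section \<open>Grids and progressions\<close>

lemma box_finite_card:
  fixes A :: "'i \<Rightarrow> 'b set"
  assumes "finite I" "\<And>i. i \<in> I \<Longrightarrow> finite (A i)"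
  shows box_finite: "finite {x. (\<forall>i\<in>I. x i \<in> A i) \<and> (\<forall>i. i \<notin> I \<longrightarrow> x i = c i)}"
    and box_card: "card {x. (\<forall>i\<in>I. x i \<in> A i) \<and> (\<forall>i. i \<notin> I \<longrightarrow> x i = c i)} = (\<Prod>i\<in>I. card (A i))"
proof -
  let ?S = "{x. (\<forall>i\<in>I. x i \<in> A i) \<and> (\<forall>i. i \<notin> I \<longrightarrow> x i = c i)}"
  have "bij_betw (\<lambda>f i. if i \<in> I then f i else c i) (PiE I A) ?S"
  proof (rule bij_betw_byWitness[where f' = "\<lambda>x. restrict x I"])
    show "\<forall>f\<in>PiE I A. restrict (\<lambda>i. if i \<in> I then f i else c i) I = f"
      by (auto simp: fun_eq_iff PiE_def extensional_def)
  qed (auto simp: fun_eq_iff PiE_def)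
  from bij_betw_finite[OF this] bij_betw_same_card[OF this]
  show "finite ?S" "card ?S = (\<Prod>i\<in>I. card (A i))"
    using assms by (auto simp: finite_PiE card_PiE)
qed

lemma grid_finite_card:
  shows grid_finite: "finite (grid d N)" and grid_card: "card (grid d N) = (\<Prod>i<d. N i)"
proof -
  have "grid d N = {x. (\<forall>i\<in>{..<d}. x i \<in> {1..int (N i)}) \<and> (\<forall>i. i \<notin> {..<d} \<longrightarrow> x i = 0)}"
    by (auto simp: grid_def not_less)
  then show "finite (grid d N)" "card (grid d N) = (\<Prod>i<d. N i)"
    using box_finite[of "{..<d}" "\<lambda>i. {1..int (N i)}" "\<lambda>_. 0"] box_card[of "{..<d}" "\<lambda>i. {1..int (N i)}" "\<lambda>_. 0"] by auto
qed

lemma grid_subset_zvec: "grid d N \<subseteq> zvec d"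
  by (auto simp: grid_def zvec_def)

lemma mem_ap_set: "i < l \<Longrightarrow> (\<lambda>j. a j + int i * b j) \<in> ap_set a b l"
  by (auto simp: ap_set_def)

lemma APs_subset_grid: "A \<in> APs d N \<Longrightarrow> A \<subseteq> grid d N"
  by (auto simp: APs_def)

lemma ap_inj:
  assumes "b \<noteq> (\<lambda>_. 0 :: int)"
  shows "inj (\<lambda>i j. a j + int i * b j)"
proof (rule injI)
  fix i i' assume e: "(\<lambda>j. a j + int i * b j) = (\<lambda>j. a j + int i' * b j)"
  obtain j where "b j \<noteq> 0" using assms by (auto simp: fun_eq_iff)
  with fun_cong[OF e, of j] show "i = i'" by simp
qed

lemma ap_card:
  assumes "b \<noteq> (\<lambda>_. 0 :: int)"
  shows "card (ap_set a b l) = l"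
proof -
  have "ap_set a b l = (\<lambda>i j. a j + int i * b j) ` {..<l}" by (auto simp: ap_set_def)
  then show ?thesis using card_image[OF inj_on_subset[OF ap_inj[OF assms, of a]]] by simp
qed

lemma singleton_in_APs:
  assumes "d > 0" "x \<in> grid d N"
  shows "{x} \<in> APs d N"
proof -
  define b :: "nat \<Rightarrow> int" where "b j = (if j = 0 then 1 else 0)" for j
  have "b \<in> zvec d" "b \<noteq> (\<lambda>_. 0)" using assms by (auto simp: zvec_def b_def fun_eq_iff)
  moreover have "ap_set x b 1 = {x}" by (auto simp: ap_set_def)
  ultimately show ?thesis
    unfolding APs_def using assms grid_subset_zvec by (intro CollectI exI[of _ x] exI[of _ b] exI[of _ 1]) auto
qed

text \<open>A progression is determined by its first two terms and its length.\<close>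

lemma APs_finite_card:
  shows APs_finite: "finite (APs d N)" and APs_card_le: "card (APs d N) \<le> (\<Prod>i<d. N i) ^ 3"
proof -
  let ?G = "grid d N" and ?P = "\<Prod>i<d. N i"
  let ?f = "\<lambda>(x, y, l). ap_set x (\<lambda>j. y j - x j) l"
  have sub: "APs d N \<subseteq> ?f ` (?G \<times> ?G \<times> {1..?P})"
  proof
    fix A assume "A \<in> APs d N"
    then obtain a b l where A: "A = ap_set a b l" "b \<noteq> (\<lambda>_. 0)" "l \<ge> 1" "ap_set a b l \<subseteq> ?G"
      by (auto simp: APs_def)
    have "l \<le> ?P" using card_mono[OF grid_finite A(4)] ap_card[OF A(2)] by (simp add: grid_card)
    have a: "a \<in> ?G" using mem_ap_set[of 0 l a b] A by auto
    \<comment> \<open>For a single term the point a + b may lie outside the grid, so the first term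
      is repeated. The resulting difference 0 is harmless at length 1.\<close>
    define y where "y = (if l = 1 then a else (\<lambda>j. a j + b j))"
    have "y \<in> ?G" using a mem_ap_set[of 1 l a b] A by (auto simp: y_def)
    moreover have "ap_set a (\<lambda>j. y j - a j) l = A"
      unfolding A(1) by (cases "l = 1") (auto simp: y_def ap_set_def)
    ultimately show "A \<in> ?f ` (?G \<times> ?G \<times> {1..?P})"
      using a A(3) \<open>l \<le> ?P\<close> by (intro image_eqI[of _ _ "(a, y, l)"]) auto
  qed
  have fin: "finite (?G \<times> ?G \<times> {1..?P})" using grid_finite by auto
  from finite_subset[OF sub] fin show "finite (APs d N)" by blast
  have "card (APs d N) \<le> card (?G \<times> ?G \<times> {1..?P})"
    using card_mono[OF finite_imageI[OF fin] sub] card_image_le[OF fin, of ?f] by linarith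
  also have "\<dots> = ?P ^ 3" by (simp add: card_cartesian_product grid_card power3_eq_cube mult.assoc)
  finally show "card (APs d N) \<le> ?P ^ 3" .
qed

lemma grid_nonempty:
  assumes "\<forall>i<d. N i > 0"
  shows "grid d N \<noteq> {}"
proof -
  have "(\<lambda>i. if i < d then 1 else 0) \<in> grid d N" using assms by (auto simp: grid_def Suc_le_eq)
  then show ?thesis by blast
qed

lemma APs_nonempty:
  assumes "d > 0" "\<forall>i<d. N i > 0"
  shows "APs d N \<noteq> {}"
  using singleton_in_APs[OF assms(1)] grid_nonempty[OF assms(2)] by blast

lemma colourings_finite: "finite (grid d N \<rightarrow>\<^sub>E {1, -1 :: int})"
  using grid_finite by (intro finite_PiE) auto

lemma disc_AP_le:
  assumes "d > 0" "\<forall>i<d. N i > 0" and "\<And>x. x \<in> grid d N \<Longrightarrow> \<bar>\<epsilon> x\<bar> = (1::real)"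
    and B: "\<And>A. A \<in> APs d N \<Longrightarrow> \<bar>\<Sum>x\<in>A. \<epsilon> x\<bar> \<le> B"
  shows "real_of_int (disc_AP d N) \<le> B"
proof -
  define c where "c = restrict (\<lambda>x. if \<epsilon> x = 1 then 1 else -1 :: int) (grid d N)"
  have c: "c \<in> grid d N \<rightarrow>\<^sub>E {1, -1}" by (auto simp: c_def)
  let ?M = "Max ((\<lambda>A. \<bar>\<Sum>x\<in>A. c x\<bar>) ` APs d N)"
  have "disc_AP d N \<le> ?M"
    unfolding disc_AP_def using c colourings_finite by (intro Min_le) auto
  moreover have "?M \<in> (\<lambda>A. \<bar>\<Sum>x\<in>A. c x\<bar>) ` APs d N"
    using APs_finite APs_nonempty[OF assms(1,2)] by (intro Max_in) auto
  then obtain A where A: "A \<in> APs d N" "?M = \<bar>\<Sum>x\<in>A. c x\<bar>" by blast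
  have "real_of_int (\<Sum>x\<in>A. c x) = (\<Sum>x\<in>A. \<epsilon> x)"
    unfolding of_int_sum
  proof (rule sum.cong)
    fix x assume "x \<in> A"
    then have "x \<in> grid d N" using APs_subset_grid[OF A(1)] by blast
    then show "real_of_int (c x) = \<epsilon> x" using assms(3)[of x] by (auto simp: c_def)
  qed simp
  then have "real_of_int ?M \<le> B" using B[OF A(1)] unfolding A(2) by (metis of_int_abs)
  ultimately show ?thesis by linarith
qed

lemma disc_AP_attained:
  assumes "d > 0" "\<forall>i<d. N i > 0"
  obtains c where "\<And>x. x \<in> grid d N \<Longrightarrow> c x \<in> {1, -1 :: int}"
    and "\<And>A. A \<in> APs d N \<Longrightarrow> \<bar>\<Sum>x\<in>A. c x\<bar> \<le> disc_AP d N"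
proof -
  let ?C = "grid d N \<rightarrow>\<^sub>E {1, -1 :: int}"
  let ?m = "\<lambda>c. Max ((\<lambda>A. \<bar>\<Sum>x\<in>A. c x\<bar>) ` APs d N) :: int"
  have "?C \<noteq> {}" by (auto simp: PiE_eq_empty_iff)
  then have "disc_AP d N \<in> ?m ` ?C"
    unfolding disc_AP_def using colourings_finite by (intro Min_in) auto
  then obtain c where c: "c \<in> ?C" "disc_AP d N = ?m c" by blast
  show ?thesis
  proof (rule that[of c])
    show "c x \<in> {1, -1}" if "x \<in> grid d N" for x using c(1) that by (auto simp: PiE_def Pi_def)
    show "\<bar>\<Sum>x\<in>A. c x\<bar> \<le> disc_AP d N" if "A \<in> APs d N" for A
      unfolding c(2) using that APs_finite by (intro Max_ge) auto
  qed
qed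

section \<open>Upper bound\<close>

lemma int_div_less_iff_mult:
  fixes z t n :: int
  assumes "n > 0"
  shows "z div n < t \<longleftrightarrow> z < t * n"
proof
  assume "z div n < t"
  then have "(z div n + 1) * n \<le> t * n" using assms by (intro mult_right_mono) auto
  moreover have "z < (z div n + 1) * n"
    unfolding distrib_right using assms div_mult_mod_eq[of z n] pos_mod_bound[of n z] by linarith
  ultimately show "z < t * n" by linarith
next
  assume z: "z < t * n"
  show "z div n < t"
  proof (rule ccontr)
    assume "\<not> z div n < t"
    then have "t * n \<le> (z div n) * n" using assms by (intro mult_right_mono) auto
    also have "\<dots> \<le> z" using assms div_mult_mod_eq[of z n] pos_mod_sign[of n z] by linarith
    finally show False using z by simp
  qed
qed

text \<open>Blocks are aligned to multiples of \<open>n\<close>, so the same blocks serve all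
  intervals; at most \<open>n\<close> points stick out at each end. The identity of indicators
  encodes disjointness as well and is the form needed by
  \<open>discrepancy_via_blocks\<close>.\<close>

lemma interval_split_blocks:
  fixes s t :: int and n :: nat
  assumes n: "n \<ge> 1" and st: "s \<le> t"
  obtains E s' t' where "finite E" "card E \<le> 2 * n" "s' \<le> t'" "(t' - s') * int n \<le> t - s"
    "\<And>z. of_bool (s \<le> z \<and> z < t) = (of_bool (z \<in> E) + of_bool (s' \<le> z div int n \<and> z div int n < t') :: real)"
proof -
  let ?n = "int n"
  have np: "?n > 0" using n by simp
  \<comment> \<open>The ceiling of s / n, while \<open>v\<close> is the floor of t / n.\<close>
  define u where "u = - ((- s) div ?n)"
  define v where "v = t div ?n"
  have u: "s \<le> u * ?n" "u * ?n < s + ?n"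
    using np div_mult_mod_eq[of "- s" ?n] pos_mod_sign[of ?n "- s"] pos_mod_bound[of ?n "- s"]
    unfolding u_def mult_minus_left by linarith+
  have v: "v * ?n \<le> t" "t < v * ?n + ?n"
    using np div_mult_mod_eq[of t ?n] pos_mod_sign[of ?n t] pos_mod_bound[of ?n t] unfolding v_def
    by linarith+
  have iff: "(a \<le> z div ?n \<and> z div ?n < b) \<longleftrightarrow> (a * ?n \<le> z \<and> z < b * ?n)" for a b z
    using int_div_less_iff_mult[OF np, of z a] int_div_less_iff_mult[OF np, of z b] by linarith
  show ?thesis
  proof (cases "u \<le> v")
    case True
    then have uv: "u * ?n \<le> v * ?n" by (intro mult_right_mono) auto
    show ?thesis
    proof (rule that[of "{s..<u * ?n} \<union> {v * ?n..<t}" u v])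
      have "card ({s..<u * ?n} \<union> {v * ?n..<t}) \<le> card {s..<u * ?n} + card {v * ?n..<t}" by (rule card_Un_le)
      also have "\<dots> \<le> 2 * n" using u v by auto
      finally show "card ({s..<u * ?n} \<union> {v * ?n..<t}) \<le> 2 * n" .
      show "(v - u) * ?n \<le> t - s" using u v by (simp add: left_diff_distrib)
      fix z
      have aux: "of_bool (s \<le> z \<and> z < t) = (of_bool (z \<in> {s..<p} \<union> {q..<t}) + of_bool (p \<le> z \<and> z < q) :: real)"
        if "s \<le> p" "p \<le> q" "q \<le> t" for p q using that by auto
      show "of_bool (s \<le> z \<and> z < t) = (of_bool (z \<in> {s..<u * ?n} \<union> {v * ?n..<t})
          + of_bool (u \<le> z div ?n \<and> z div ?n < v) :: real)"
        unfolding iff by (rule aux[OF u(1) uv v(1)])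
    qed (use True in auto)
  next
    case False
    \<comment> \<open>The two roundings cross only if the interval has at most \<open>n\<close>
      points, and then all of them count as single points.\<close>
    then have "(v + 1) * ?n \<le> u * ?n" by (intro mult_right_mono) auto
    then have "t - s \<le> ?n" using u v by (simp add: algebra_simps)
    then show ?thesis by (intro that[of "{s..<t}" 0 0]) (use st in auto)
  qed
qed

text \<open>The block indices left by the first cut form an interval again, which is cut once more
  with length \<open>k\<close>. For an interval of length at most n k^2 this leaves at most 3k
  blocks in place of about k^2.\<close>

lemma interval_split_two_levels:
  fixes s t :: int and n k :: nat
  assumes n: "n \<ge> 1" and k: "k \<ge> 1" and st: "s \<le> t"
  obtains E F1 F2 where "finite E" "finite F1" "finite F2" "card E \<le> 2 * n" "card F1 \<le> 2 * k"
    "int (card F2) * int (n * k) \<le> t - s"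
    "\<And>z. of_bool (s \<le> z \<and> z < t) =
      (of_bool (z \<in> E) + of_bool (z div int n \<in> F1) + of_bool (z div int (n * k) \<in> F2) :: real)"
proof -
  obtain E s' t' where 1: "finite E" "card E \<le> 2 * n" "s' \<le> t'" "(t' - s') * int n \<le> t - s"
    "\<And>z. of_bool (s \<le> z \<and> z < t) = (of_bool (z \<in> E) + of_bool (s' \<le> z div int n \<and> z div int n < t') :: real)"
    using interval_split_blocks[OF n st] by metis
  obtain F a b where 2: "finite F" "card F \<le> 2 * k" "a \<le> b" "(b - a) * int k \<le> t' - s'"
    "\<And>z. of_bool (s' \<le> z \<and> z < t') = (of_bool (z \<in> F) + of_bool (a \<le> z div int k \<and> z div int k < b) :: real)"
    using interval_split_blocks[OF k 1(3)] by metis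
  show ?thesis
  proof (rule that[of E F "{a..<b}"])
    have "(b - a) * int k * int n \<le> (t' - s') * int n" using 2(4) by (intro mult_right_mono) auto
    then show "int (card {a..<b}) * int (n * k) \<le> t - s"
      using 1(4) 2(3) by (simp add: mult_ac)
    fix z
    have "z div int n div int k = z div int (n * k)" by (simp add: zdiv_zmult2_eq)
    then show "of_bool (s \<le> z \<and> z < t) =
      (of_bool (z \<in> E) + of_bool (z div int n \<in> F) + of_bool (z div int (n * k) \<in> {a..<b}) :: real)"
      unfolding 1(5) 2(5) by simp
  qed (use 1 2 in auto)
qed

text \<open>The position along direction b is read off the first nonzero coordinate of b; removing that
  multiple of b leaves an invariant of the residue class modulo b.\<close>

definition dir_pos :: "(nat \<Rightarrow> int) \<Rightarrow> (nat \<Rightarrow> int) \<Rightarrow> int" where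
  "dir_pos b x = x (LEAST i. b i \<noteq> 0) div b (LEAST i. b i \<noteq> 0)"

definition dir_root :: "(nat \<Rightarrow> int) \<Rightarrow> (nat \<Rightarrow> int) \<Rightarrow> nat \<Rightarrow> int" where
  "dir_root b x = (\<lambda>j. x j - dir_pos b x * b j)"

lemma dir_pos_shift:
  assumes "b \<noteq> (\<lambda>_. 0)"
  shows "dir_pos b (\<lambda>j. a j + k * b j) = dir_pos b a + k"
proof -
  have "\<exists>i. b i \<noteq> 0" using assms by auto
  then have "b (LEAST i. b i \<noteq> 0) \<noteq> 0" by (rule LeastI_ex)
  then show ?thesis by (simp add: dir_pos_def)
qed

lemma dir_root_shift:
  assumes "b \<noteq> (\<lambda>_. 0)"
  shows "dir_root b (\<lambda>j. a j + k * b j) = dir_root b a"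
  unfolding dir_root_def dir_pos_shift[OF assms] by (simp add: algebra_simps)

lemma dir_decompose: "x = (\<lambda>j. dir_root b x j + dir_pos b x * b j)"
  by (simp add: dir_root_def)

text \<open>Progressions with difference \<open>b\<close> become integer intervals of positions
  within one residue class, to which the interval cuts apply.\<close>

lemma mem_ap_set_iff_dir:
  assumes b: "b \<noteq> (\<lambda>_. 0)"
  shows "x \<in> ap_set a b l \<longleftrightarrow>
    dir_root b x = dir_root b a \<and> dir_pos b a \<le> dir_pos b x \<and> dir_pos b x < dir_pos b a + int l"
proof
  assume "x \<in> ap_set a b l"
  then obtain i where "i < l" "x = (\<lambda>j. a j + int i * b j)" by (auto simp: ap_set_def)
  then show "dir_root b x = dir_root b a \<and> dir_pos b a \<le> dir_pos b x \<and> dir_pos b x < dir_pos b a + int l"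
    using dir_pos_shift[OF b] dir_root_shift[OF b] by auto
next
  assume r: "dir_root b x = dir_root b a \<and> dir_pos b a \<le> dir_pos b x \<and> dir_pos b x < dir_pos b a + int l"
  define i where "i = nat (dir_pos b x - dir_pos b a)"
  have i: "i < l" "dir_pos b x = dir_pos b a + int i" using r by (auto simp: i_def)
  have "x = (\<lambda>j. dir_root b a j + (dir_pos b a + int i) * b j)"
    using dir_decompose[of x b] r i by simp
  also have "\<dots> = (\<lambda>j. a j + int i * b j)"
    by (simp add: dir_root_def algebra_simps)
  finally show "x \<in> ap_set a b l" using i mem_ap_set by metis
qed

text \<open>A progression in the grid with more than \<open>s\<close> terms must have its difference
  in this set.\<close>

definition short_dirs :: "nat \<Rightarrow> (nat \<Rightarrow> nat) \<Rightarrow> nat \<Rightarrow> (nat \<Rightarrow> int) set" where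
  "short_dirs d N s = {b \<in> zvec d. b \<noteq> (\<lambda>_. 0) \<and> (\<forall>i<d. int s * \<bar>b i\<bar> \<le> int (N i))}"

text \<open>Only coordinates with N_i >= s = l m can be nonzero; let \<open>I\<close> be their set.
  Each offers at most 3 N_i / s values, and the product of the sides over \<open>I\<close> is at
  most L^(|I|+1), while s^|I| is at least L^|I| m. That last step needs \<open>I\<close> nonempty;
  if it is empty, no nonzero difference exists.\<close>

lemma short_dirs_finite_card:
  assumes l: "l \<ge> 1" "real l \<ge> L" "L \<ge> 1" and m: "m \<ge> 1"
    and L: "\<And>I. I \<subseteq> {..<d} \<Longrightarrow> (\<Prod>i\<in>I. real (N i)) \<le> L ^ (card I + 1)"
  shows short_dirs_finite: "finite (short_dirs d N (l * m))"
    and short_dirs_card: "real (card (short_dirs d N (l * m))) \<le> 3 ^ d * L / real m"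
proof -
  define s where "s = l * m"
  have s: "s \<ge> 1" using l(1) m by (simp add: s_def)
  define q where "q i = N i div s" for i
  let ?A = "\<lambda>i. {- int (q i)..int (q i)}"
  let ?B = "{x. (\<forall>i\<in>{..<d}. x i \<in> ?A i) \<and> (\<forall>i. i \<notin> {..<d} \<longrightarrow> x i = (0::int))}"
  have le_q: "\<bar>z\<bar> \<le> int (q i)" if "int s * \<bar>z\<bar> \<le> int (N i)" for z i
  proof -
    have "s * nat \<bar>z\<bar> \<le> N i" using that by (metis int_nat_eq abs_ge_zero of_nat_le_iff of_nat_mult)
    then have "nat \<bar>z\<bar> \<le> q i" using s unfolding q_def by (simp add: less_eq_div_iff_mult_less_eq mult.commute)
    then show ?thesis by linarith
  qed
  have sub: "short_dirs d N s \<subseteq> ?B"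
    using le_q by (fastforce simp: short_dirs_def zvec_def abs_le_iff)
  have fB: "finite ?B" by (rule box_finite) auto
  show "finite (short_dirs d N (l * m))" using finite_subset[OF sub fB] by (simp add: s_def)
  define I where "I = {i\<in>{..<d}. q i \<ge> 1}"
  show "real (card (short_dirs d N (l * m))) \<le> 3 ^ d * L / real m"
  proof (cases "I = {}")
    case True
    have "short_dirs d N s = {}"
    proof (rule ccontr)
      assume "short_dirs d N s \<noteq> {}"
      then obtain b where b: "b \<in> short_dirs d N s" by blast
      then obtain i where i: "b i \<noteq> 0" by (auto simp: short_dirs_def)
      then have "i < d" using b by (auto simp: short_dirs_def zvec_def not_less[symmetric])
      then have "\<bar>b i\<bar> \<le> int (q i)" using b le_q by (auto simp: short_dirs_def)
      then show False using True i \<open>i < d\<close> by (auto simp: I_def)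
    qed
    then show ?thesis using l(3) by (simp add: s_def)
  next
    case False
    have fI: "finite I" by (simp add: I_def)
    have I: "I \<subseteq> {..<d}" by (auto simp: I_def)
    have "card (short_dirs d N s) \<le> card ?B" by (rule card_mono[OF fB sub])
    also have "\<dots> = (\<Prod>i<d. 2 * q i + 1)"
      by (subst box_card) (auto simp: nat_add_distrib nat_mult_distrib)
    also have "\<dots> = (\<Prod>i\<in>I. 2 * q i + 1)"
      by (rule prod.mono_neutral_right) (auto simp: I_def)
    finally have "real (card (short_dirs d N s)) \<le> (\<Prod>i\<in>I. real (2 * q i + 1))"
      by (metis of_nat_le_iff of_nat_prod)
    also have "\<dots> \<le> (\<Prod>i\<in>I. 3 * (real (N i) / real s))"
    proof (rule prod_mono)
      fix i assume "i \<in> I"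
      then have "real (2 * q i + 1) \<le> 3 * real (q i)" by (auto simp: I_def)
      also have "real (q i) \<le> real (N i) / real s" unfolding q_def by (rule of_nat_div_le_of_nat)
      finally show "0 \<le> real (2 * q i + 1) \<and> real (2 * q i + 1) \<le> 3 * (real (N i) / real s)" by simp
    qed
    also have "\<dots> = 3 ^ card I * ((\<Prod>i\<in>I. real (N i)) / real s ^ card I)"
      by (simp add: prod.distrib prod_dividef)
    also have "\<dots> \<le> 3 ^ d * (L / real m)"
    proof (rule mult_mono)
      show "(3::real) ^ card I \<le> 3 ^ d"
        using card_mono[OF _ I] by (intro power_increasing) auto
      have "L ^ card I * real m \<le> L ^ card I * real m ^ card I"
        using False fI m l by (intro mult_left_mono self_le_power) (auto simp: Suc_le_eq card_gt_0_iff)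
      also have "\<dots> \<le> real l ^ card I * real m ^ card I"
        using l by (intro mult_right_mono power_mono) auto
      finally have "L ^ card I * real m \<le> real s ^ card I" by (simp add: s_def power_mult_distrib)
      then have "L * (L ^ card I * real m) \<le> L * real s ^ card I" using l by (intro mult_left_mono) auto
      then have "L ^ (card I + 1) / real s ^ card I \<le> L / real m"
        using s m by (simp add: field_simps)
      moreover have "(\<Prod>i\<in>I. real (N i)) / real s ^ card I \<le> L ^ (card I + 1) / real s ^ card I"
        using L[OF I] by (intro divide_right_mono) auto
      ultimately show "(\<Prod>i\<in>I. real (N i)) / real s ^ card I \<le> L / real m" by linarith
    qed (auto intro!: prod_nonneg divide_nonneg_nonneg)
    finally show ?thesis by (simp add: s_def)
  qed
qed

lemma sum_inverse_squares_le: "(\<Sum>k=1..<n. 1 / real k ^ 2) \<le> 2"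
proof -
  have "(\<Sum>k=1..<Suc n. 1 / real k ^ 2) \<le> 2 - 1 / real n" if "n \<ge> 1" for n
    using that
  proof (induction n rule: nat_induct_at_least)
    case base
    then show ?case by simp
  next
    case (Suc n)
    have "1 / real (Suc n) ^ 2 \<le> 1 / (real n * real (Suc n))"
      using Suc.hyps by (intro divide_left_mono) (auto simp: power2_eq_square)
    also have "\<dots> = 1 / real n - 1 / real (Suc n)" using Suc.hyps by (simp add: field_simps)
    finally show ?case using Suc by simp
  qed
  note * = this
  show ?thesis
  proof (cases "n \<ge> 2")
    case True
    then have "(\<Sum>k=1..<n. 1 / real k ^ 2) \<le> 2 - 1 / real (n - 1)" using *[of "n - 1"] by simp
    also have "\<dots> \<le> 2" by simp
    finally show ?thesis .
  next
    case False
    then have "{1..<n} = {}" by auto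
    then show ?thesis by simp
  qed
qed

text \<open>Second-level blocks in direction b consist of this many first-level blocks; it is about the
  square root of the number of first-level blocks on a line, which balances the cost of the two levels.\<close>

definition block_ratio :: "nat \<Rightarrow> (nat \<Rightarrow> nat) \<Rightarrow> nat \<Rightarrow> (nat \<Rightarrow> int) \<Rightarrow> nat" where
  "block_ratio d N l b = (LEAST k. k \<ge> 1 \<and> (\<exists>i<d. int (l * k\<^sup>2) * \<bar>b i\<bar> > int (N i)))"

lemma block_ratio_props:
  assumes b: "b \<in> zvec d" "b \<noteq> (\<lambda>_. 0)" and l: "l \<ge> 1"
  shows "block_ratio d N l b \<ge> 1"
    and "\<exists>i<d. int (l * (block_ratio d N l b)\<^sup>2) * \<bar>b i\<bar> > int (N i)"
    and "\<And>k. 1 \<le> k \<Longrightarrow> k < block_ratio d N l b \<Longrightarrow> b \<in> short_dirs d N (l * k\<^sup>2)"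
proof -
  let ?P = "\<lambda>k. k \<ge> 1 \<and> (\<exists>i<d. int (l * k\<^sup>2) * \<bar>b i\<bar> > int (N i))"
  obtain i where i: "b i \<noteq> 0" using b by auto
  have id: "i < d" using i b by (auto simp: zvec_def not_less[symmetric])
  \<comment> \<open>The ratio N_i + 1 qualifies, so the least one exists.\<close>
  have "int (N i) < int (l * (N i + 1)\<^sup>2) * \<bar>b i\<bar>"
  proof -
    have "int (N i) < int (N i + 1) * 1" by simp
    also have "\<dots> \<le> int (l * (N i + 1)\<^sup>2) * \<bar>b i\<bar>"
    proof (intro mult_mono)
      have "(N i + 1) * 1 \<le> (N i + 1)\<^sup>2 * l" using l unfolding power2_eq_square by (intro mult_mono) auto
      then show "int (N i + 1) \<le> int (l * (N i + 1)\<^sup>2)" by (metis mult.commute mult_1 of_nat_le_iff)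
    qed (use i in auto)
    finally show ?thesis .
  qed
  then have ex: "\<exists>k. ?P k" using id by (intro exI[of _ "N i + 1"]) auto
  from LeastI_ex[OF ex] show "block_ratio d N l b \<ge> 1"
    and "\<exists>i<d. int (l * (block_ratio d N l b)\<^sup>2) * \<bar>b i\<bar> > int (N i)"
    unfolding block_ratio_def by blast+
  fix k :: nat assume k: "1 \<le> k" "k < block_ratio d N l b"
  then have "\<not> ?P k" unfolding block_ratio_def using not_less_Least by blast
  then show "b \<in> short_dirs d N (l * k\<^sup>2)" using b k by (auto simp: short_dirs_def not_less) (metis not_le)
qed

text \<open>Summation by layers: each ratio is 1 plus the number of k >= 1 below it. A ratio above k
  puts \<open>b\<close> into \<open>short_dirs d N (l * k\<^sup>2)\<close>, which has at most 3^d L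
  / k^2 elements. The factor 3 is 1 for the first term and 2 for the sum of inverse squares.\<close>

lemma sum_block_ratio_le:
  assumes l: "l \<ge> 1" "real l \<ge> L" "L \<ge> 1"
    and L: "\<And>I. I \<subseteq> {..<d} \<Longrightarrow> (\<Prod>i\<in>I. real (N i)) \<le> L ^ (card I + 1)"
  shows "(\<Sum>b\<in>short_dirs d N l. real (block_ratio d N l b)) \<le> 3 * 3 ^ d * L"
proof -
  let ?D = "short_dirs d N l" and ?k = "block_ratio d N l"
  have fD: "finite ?D" using short_dirs_finite[OF l, of 1 d N] L by simp
  have cD: "real (card ?D) \<le> 3 ^ d * L" using short_dirs_card[OF l, of 1 d N] L by simp
  define n where "n = Suc (Max (insert 0 (?k ` ?D)))"
  have n: "?k b < n" if "b \<in> ?D" for b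
    unfolding n_def using that fD by (intro le_imp_less_Suc Max_ge) auto
  have D: "b \<in> zvec d" "b \<noteq> (\<lambda>_. 0)" if "b \<in> ?D" for b using that by (auto simp: short_dirs_def)
  have "real (?k b) = 1 + (\<Sum>k=1..<n. of_bool (k < ?k b))" if "b \<in> ?D" for b
  proof -
    have "(\<Sum>k=1..<n. of_bool (k < ?k b)) = real (card ({1..<n} \<inter> {k. k < ?k b}))"
      by (simp add: sum_of_bool_eq)
    also have "{1..<n} \<inter> {k. k < ?k b} = {1..<?k b}" using n[OF that] by auto
    also have "real (card {1..<?k b}) = real (?k b) - 1"
      using block_ratio_props(1)[OF D[OF that] l(1), of N] by (simp add: of_nat_diff)
    finally show ?thesis by linarith
  qed
  then have "(\<Sum>b\<in>?D. real (?k b)) = (\<Sum>b\<in>?D. 1 + (\<Sum>k=1..<n. of_bool (k < ?k b)))"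
    by (intro sum.cong) auto
  also have "\<dots> = real (card ?D) + (\<Sum>k=1..<n. \<Sum>b\<in>?D. of_bool (k < ?k b))"
    by (simp add: sum.distrib sum.swap[of _ ?D] del: sum_of_bool_eq)
  also have "(\<Sum>k=1..<n. \<Sum>b\<in>?D. of_bool (k < ?k b)) \<le> (\<Sum>k=1..<n. 3 ^ d * L * (1 / real k ^ 2))"
  proof (intro sum_mono)
    fix k assume k: "k \<in> {1..<n}"
    have k2: "k\<^sup>2 \<ge> 1" using k by simp
    have "(\<Sum>b\<in>?D. of_bool (k < ?k b)) = real (card (?D \<inter> {b. k < ?k b}))" using fD by (simp add: sum_of_bool_eq)
    also have "\<dots> \<le> real (card (short_dirs d N (l * k\<^sup>2)))"
      using k block_ratio_props(3)[OF D l(1), of _ k N] short_dirs_finite[OF l k2 L]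
      by (intro of_nat_mono card_mono) auto
    also have "\<dots> \<le> 3 ^ d * L / real (k\<^sup>2)" by (rule short_dirs_card[OF l k2 L])
    finally show "(\<Sum>b\<in>?D. of_bool (k < ?k b)) \<le> 3 ^ d * L * (1 / real k ^ 2)" by simp
  qed
  also have "\<dots> \<le> 3 ^ d * L * 2"
    unfolding sum_distrib_left[symmetric] using sum_inverse_squares_le[of n] l by (intro mult_left_mono) auto
  finally show ?thesis using cD by linarith
qed


text \<open>\<open>discrepancy_via_blocks\<close> is applied with T = 7 3^d and R = 5 l <= 10 L. At
  most P^3 progressions give 2 ln (2 P^3) <= 8 ln P, and 7 * 10 * 8 = 560.\<close>

lemma disc_AP_le_scale:
  assumes d: "d > 0" and N: "\<forall>i<d. N i > 0" and P: "(\<Prod>i<d. N i) \<ge> 2" and L1: "L \<ge> 1"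
    and L: "\<And>I. I \<subseteq> {..<d} \<Longrightarrow> (\<Prod>i\<in>I. real (N i)) \<le> L ^ (card I + 1)"
  shows "real_of_int (disc_AP d N) \<le> sqrt (560 * 3 ^ d * L * ln (real (\<Prod>i<d. N i)))"
proof -
  define l where "l = nat \<lceil>L\<rceil>"
  have l: "l \<ge> 1" "real l \<ge> L" "real l \<le> 2 * L" using L1 unfolding l_def by linarith+
  let ?G = "grid d N" and ?D = "short_dirs d N l"
  define kr where "kr = block_ratio d N l"
  have fD: "finite ?D" using short_dirs_finite[OF l(1,2) L1, of 1 d N] L by simp
  have D: "b \<in> zvec d" "b \<noteq> (\<lambda>_. 0)" if "b \<in> ?D" for b using that by (auto simp: short_dirs_def)
  have kr1: "kr b \<ge> 1" if "b \<in> ?D" for b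
    using block_ratio_props(1)[OF D[OF that] l(1)] by (simp add: kr_def)
  define len where "len b lev = (if lev then l * kr b else l)" for b and lev :: bool
  define ix where "ix x b lev = (b, lev, dir_root b x, dir_pos b x div int (len b lev))" for x b lev
  \<comment> \<open>Either a single point, or the positions with quotient \<open>j\<close> on the
    residue class \<open>r\<close> modulo \<open>b\<close>; \<open>lev\<close> selects the shorter
    or the longer block length.\<close>
  define block where "block k = (case k of Inl y \<Rightarrow> {y}
      | Inr (b, lev, r, j) \<Rightarrow> {x. dir_root b x = r \<and> dir_pos b x div int (len b lev) = j})"
    for k :: "(nat \<Rightarrow> int) + ((nat \<Rightarrow> int) \<times> bool \<times> (nat \<Rightarrow> int) \<times> int)"
  \<comment> \<open>A long progression uses at most 3 k_b blocks in its direction, so this weight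
    makes them cost 3 l in total, comparable to its 2 l single points.\<close>
  define \<tau> where "\<tau> k = (case k of Inl y \<Rightarrow> 1 | Inr (b, lev, r, j) \<Rightarrow> real (kr b) / real l)"
    for k :: "(nat \<Rightarrow> int) + ((nat \<Rightarrow> int) \<times> bool \<times> (nat \<Rightarrow> int) \<times> int)"
  define K where "K = Inl ` ?G \<union> (\<lambda>(x, b, lev). Inr (ix x b lev)) ` (?G \<times> ?D \<times> UNIV)"
  have fK: "finite K" unfolding K_def using fD grid_finite by auto
  have \<tau>pos: "\<tau> k > 0" if "k \<in> K" for k
    using that kr1 l(1) unfolding K_def \<tau>_def ix_def by (fastforce simp: Suc_le_eq)
  have T: "(\<Sum>k | k \<in> K \<and> x \<in> block k. \<tau> k) \<le> 7 * 3 ^ d" if x: "x \<in> ?G" for x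
  proof -
    \<comment> \<open>Besides its singleton, a point lies in exactly one block for each direction
      and level.\<close>
    have "{k. k \<in> K \<and> x \<in> block k} \<subseteq> insert (Inl x) ((\<lambda>(b, lev). Inr (ix x b lev)) ` (?D \<times> UNIV))"
    proof
      fix k assume "k \<in> {k. k \<in> K \<and> x \<in> block k}"
      then have k: "k \<in> K" "x \<in> block k" by auto
      from k(1) consider y where "k = Inl y" | y b lev where "k = Inr (ix y b lev)" "b \<in> ?D"
        unfolding K_def by auto
      then show "k \<in> insert (Inl x) ((\<lambda>(b, lev). Inr (ix x b lev)) ` (?D \<times> UNIV))"
      proof cases
        case 1
        then show ?thesis using k(2) by (simp add: block_def)
      next
        case (2 y b lev)
        then have "k = Inr (ix x b lev)" using k(2) by (simp add: block_def ix_def)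
        with 2 show ?thesis by (intro insertI2 image_eqI[of _ _ "(b, lev)"]) auto
      qed
    qed
    moreover have fin: "finite ((\<lambda>(b, lev). Inr (ix x b lev)) ` (?D \<times> UNIV))" using fD by auto
    moreover have "0 \<le> \<tau> k" for k unfolding \<tau>_def by (auto split: sum.splits)
    ultimately have "(\<Sum>k | k \<in> K \<and> x \<in> block k. \<tau> k)
      \<le> (\<Sum>k\<in>insert (Inl x) ((\<lambda>(b, lev). Inr (ix x b lev)) ` (?D \<times> UNIV)). \<tau> k)"
      by (intro sum_mono2) auto
    also have "\<dots> = 1 + (\<Sum>k\<in>(\<lambda>(b, lev). Inr (ix x b lev)) ` (?D \<times> UNIV). \<tau> k)"
      using fin by (subst sum.insert) (auto simp: \<tau>_def)
    also have "(\<Sum>k\<in>(\<lambda>(b, lev). Inr (ix x b lev)) ` (?D \<times> UNIV). \<tau> k)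
      = (\<Sum>(b, lev)\<in>?D \<times> (UNIV :: bool set). real (kr b) / real l)"
      by (subst sum.reindex) (auto simp: inj_on_def ix_def \<tau>_def intro!: sum.cong)
    also have "\<dots> = 2 * ((\<Sum>b\<in>?D. real (kr b)) / real l)"
      by (simp add: sum.cartesian_product[symmetric] sum_distrib_left sum_divide_distrib)
    also have "(\<Sum>b\<in>?D. real (kr b)) / real l \<le> 3 * 3 ^ d"
    proof -
      have "(\<Sum>b\<in>?D. real (kr b)) \<le> 3 * 3 ^ d * L"
        unfolding kr_def by (rule sum_block_ratio_le[OF l(1,2) L1 L])
      also have "\<dots> \<le> 3 * 3 ^ d * real l" using l by (intro mult_left_mono) auto
      finally show ?thesis using l(1) by (simp add: field_simps)
    qed
    finally have "(\<Sum>k | k \<in> K \<and> x \<in> block k. \<tau> k) \<le> 1 + 6 * 3 ^ d" by simp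
    also have "\<dots> \<le> 7 * 3 ^ d" using one_le_power[of "3::real" d] by simp
    finally show ?thesis .
  qed
  have "\<exists>Q. Q \<subseteq> K \<and> (\<forall>x\<in>?G. (\<Sum>k\<in>Q. indicator (block k) x) = (indicator A x :: real))
      \<and> (\<Sum>k\<in>Q. 1 / \<tau> k) \<le> 5 * real l" if A: "A \<in> APs d N" for A
  proof -
    obtain a b m where ab: "A = ap_set a b m" "b \<in> zvec d" "b \<noteq> (\<lambda>_. 0)" "m \<ge> 1" "ap_set a b m \<subseteq> ?G"
      using A by (auto simp: APs_def)
    have steps: "int (m - 1) * \<bar>b i\<bar> < int (N i)" if i: "i < d" for i
    proof -
      have "(\<lambda>j. a j + int 0 * b j) \<in> ?G" "(\<lambda>j. a j + int (m - 1) * b j) \<in> ?G"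
        using ab(4,5) mem_ap_set[of 0 m a b] mem_ap_set[of "m - 1" m a b] by auto
      then have "1 \<le> a i" "a i \<le> int (N i)" "1 \<le> a i + int (m - 1) * b i" "a i + int (m - 1) * b i \<le> int (N i)"
        using i by (auto simp: grid_def)
      then have "\<bar>int (m - 1) * b i\<bar> < int (N i)" by linarith
      then show ?thesis by (simp add: abs_mult)
    qed
    have len_bound: "m \<le> s" if "i < d" "int (N i) < int s * \<bar>b i\<bar>" for i s
    proof -
      have "int (m - 1) * \<bar>b i\<bar> < int s * \<bar>b i\<bar>" using steps[OF that(1)] that(2) by linarith
      then have "m - 1 < s" by (simp add: mult_less_cancel_right)
      then show ?thesis using ab(4) by linarith
    qed
    show ?thesis
    proof (cases "b \<in> ?D")
      case False
      then obtain i where "i < d" "int (N i) < int l * \<bar>b i\<bar>"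
        using ab by (auto simp: short_dirs_def not_le)
      then have "m \<le> l" by (rule len_bound)
      have cA: "card A = m" unfolding ab(1) by (rule ap_card[OF ab(3)])
      have "(\<Sum>k\<in>Inl ` A. indicator (block k) x) = (indicator A x :: real)" for x
        using ab(5) finite_subset[OF APs_subset_grid[OF A] grid_finite]
        by (subst sum.reindex) (auto simp: block_def inj_on_def indicator_def)
      moreover have "(\<Sum>k\<in>Inl ` A. 1 / \<tau> k) = real m"
        by (subst sum.reindex) (auto simp: \<tau>_def inj_on_def cA)
      ultimately show ?thesis using APs_subset_grid[OF A] \<open>m \<le> l\<close> unfolding K_def
        by (intro exI[of _ "Inl ` A"]) auto
    next
      case True
      define k where "k = kr b"
      have k: "k \<ge> 1" using kr1[OF True] by (simp add: k_def)
      obtain i where "i < d" "int (N i) < int (l * k\<^sup>2) * \<bar>b i\<bar>"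
        using block_ratio_props(2)[OF ab(2,3) l(1), of N] by (auto simp: kr_def k_def)
      then have ml: "m \<le> l * k\<^sup>2" by (rule len_bound)
      let ?s = "dir_pos b a"
      obtain E F1 F2 where EF: "finite E" "finite F1" "finite F2" "card E \<le> 2 * l" "card F1 \<le> 2 * k"
        "int (card F2) * int (l * k) \<le> ?s + int m - ?s"
        "\<And>z. of_bool (?s \<le> z \<and> z < ?s + int m) =
          (of_bool (z \<in> E) + of_bool (z div int l \<in> F1) + of_bool (z div int (l * k) \<in> F2) :: real)"
        using interval_split_two_levels[OF l(1) k, of ?s "?s + int m"] by auto
      \<comment> \<open>Here the choice of ratio pays off: the progression has at most l k^2 terms,
        and second-level blocks have length l k.\<close>
      have cF2: "card F2 \<le> k"
      proof -
        have "int (card F2 * (l * k)) \<le> int m" using EF(6) by simp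
        then have "card F2 * (l * k) \<le> l * k\<^sup>2" using ml by linarith
        then show ?thesis using l(1) k by (simp add: power2_eq_square)
      qed
      let ?r = "dir_root b a"
      define Q0 where "Q0 = {y\<in>?G. dir_root b y = ?r \<and> dir_pos b y \<in> E}"
      \<comment> \<open>Intersecting with \<open>K\<close> discards only blocks that miss the grid,
        since every indexed block through a grid point belongs to \<open>K\<close>.\<close>
      define Q1 where "Q1 = (\<lambda>j. Inr (b, False, ?r, j)) ` F1 \<inter> K"
      define Q2 where "Q2 = (\<lambda>j. Inr (b, True, ?r, j)) ` F2 \<inter> K"
      have cQ0: "card Q0 \<le> card E"
      proof (rule card_inj_on_le[of "dir_pos b"])
        show "inj_on (dir_pos b) Q0"
        proof (rule inj_onI)
          fix x y assume "x \<in> Q0" "y \<in> Q0" "dir_pos b x = dir_pos b y"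
          then show "x = y" using dir_decompose[of x b] dir_decompose[of y b] by (simp add: Q0_def)
        qed
      qed (auto simp: Q0_def EF)
      have cQ1: "card Q1 \<le> 2 * k"
        using card_mono[of "(\<lambda>j. Inr (b, False, ?r, j)) ` F1" Q1] card_image_le[OF EF(2)] EF(2,5)
        unfolding Q1_def by (meson Int_lower1 finite_imageI order_trans)
      have cQ2: "card Q2 \<le> k"
        using card_mono[of "(\<lambda>j. Inr (b, True, ?r, j)) ` F2" Q2] card_image_le[OF EF(3)] EF(3) cF2
        unfolding Q2_def by (meson Int_lower1 finite_imageI order_trans)
      have fQ: "finite Q0" "finite Q1" "finite Q2"
        using grid_finite fK by (auto simp: Q0_def Q1_def Q2_def)
      have dis: "Inl ` Q0 \<inter> (Q1 \<union> Q2) = {}" "Q1 \<inter> Q2 = {}" by (auto simp: Q1_def Q2_def)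
      have sumQ: "(\<Sum>k\<in>Inl ` Q0 \<union> (Q1 \<union> Q2). f k) = (\<Sum>y\<in>Q0. f (Inl y)) + ((\<Sum>k\<in>Q1. f k) + (\<Sum>k\<in>Q2. f k))"
        for f :: "_ \<Rightarrow> real"
        using fQ dis by (subst sum.union_disjoint, simp, simp, simp, subst sum.union_disjoint)
          (auto simp: sum.reindex inj_on_def)
      have "(\<Sum>k\<in>Inl ` Q0 \<union> (Q1 \<union> Q2). indicator (block k) x) = (indicator A x :: real)" if x: "x \<in> ?G" for x
      proof -
        have s0: "(\<Sum>y\<in>Q0. indicator (block (Inl y)) x) = (of_bool (dir_root b x = ?r \<and> dir_pos b x \<in> E) :: real)"
        proof -
          have "(\<Sum>y\<in>Q0. indicator (block (Inl y)) x) = (\<Sum>y\<in>Q0. if x = y then 1 else (0::real))"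
            by (intro sum.cong) (auto simp: block_def indicator_def)
          then show ?thesis using x fQ by (auto simp: Q0_def)
        qed
        have sl: "(\<Sum>k\<in>(\<lambda>j. Inr (b, lev, ?r, j)) ` F \<inter> K. indicator (block k) x)
          = (of_bool (dir_root b x = ?r \<and> dir_pos b x div int (len b lev) \<in> F) :: real)" if "finite F" for F lev
        proof -
          let ?j = "Inr (b, lev, dir_root b x, dir_pos b x div int (len b lev))"
          have "(\<Sum>k\<in>(\<lambda>j. Inr (b, lev, ?r, j)) ` F \<inter> K. indicator (block k) x)
            = (\<Sum>k\<in>(\<lambda>j. Inr (b, lev, ?r, j)) ` F \<inter> K. if ?j = k then 1 else (0::real))"
            by (intro sum.cong) (auto simp: block_def indicator_def)
          also have "\<dots> = of_bool (?j \<in> (\<lambda>j. Inr (b, lev, ?r, j)) ` F \<inter> K)" using fK by simp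
          also have "?j \<in> K"
            unfolding K_def ix_def using x True by (intro UnI2 image_eqI[of _ _ "(x, b, lev)"]) auto
          then have "?j \<in> (\<lambda>j. Inr (b, lev, ?r, j)) ` F \<inter> K \<longleftrightarrow>
            dir_root b x = ?r \<and> dir_pos b x div int (len b lev) \<in> F" by auto
          finally show ?thesis .
        qed
        have "(\<Sum>k\<in>Inl ` Q0 \<union> (Q1 \<union> Q2). indicator (block k) x) =
          of_bool (dir_root b x = ?r) * (of_bool (dir_pos b x \<in> E) + of_bool (dir_pos b x div int l \<in> F1)
            + of_bool (dir_pos b x div int (l * k) \<in> F2) :: real)"
          unfolding sumQ s0 unfolding Q1_def Q2_def sl[OF EF(2)] sl[OF EF(3)]
          by (simp add: len_def k_def)
        also have "\<dots> = of_bool (x \<in> A)"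
          unfolding EF(7)[symmetric] ab(1) mem_ap_set_iff_dir[OF ab(3)] by simp
        finally show ?thesis by (simp add: indicator_def)
      qed
      moreover have "(\<Sum>k\<in>Inl ` Q0 \<union> (Q1 \<union> Q2). 1 / \<tau> k) \<le> 5 * real l"
      proof -
        have kp: "real k > 0" using k by simp
        have "(\<Sum>k\<in>Inl ` Q0 \<union> (Q1 \<union> Q2). 1 / \<tau> k)
          = real (card Q0) + (real (card Q1) * (real l / real k) + real (card Q2) * (real l / real k))"
        proof -
          have "(\<Sum>k\<in>Q1. 1 / \<tau> k) = (\<Sum>_\<in>Q1. real l / real k)"
            by (rule sum.cong) (auto simp: Q1_def \<tau>_def k_def)
          moreover have "(\<Sum>k\<in>Q2. 1 / \<tau> k) = (\<Sum>_\<in>Q2. real l / real k)"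
            by (rule sum.cong) (auto simp: Q2_def \<tau>_def k_def)
          ultimately show ?thesis unfolding sumQ by (simp add: \<tau>_def)
        qed
        also have "\<dots> \<le> 2 * real l + (real (2 * k) * (real l / real k) + real k * (real l / real k))"
          using cQ0 EF(4) cQ1 cQ2 by (intro add_mono mult_right_mono of_nat_mono) auto
        also have "\<dots> = 5 * real l" using kp by simp
        finally show ?thesis .
      qed
      moreover have "Inl ` Q0 \<union> (Q1 \<union> Q2) \<subseteq> K" by (auto simp: Q0_def Q1_def Q2_def K_def)
      ultimately show ?thesis by blast
    qed
  qed
  then have "\<forall>A\<in>APs d N. \<exists>Q. Q \<subseteq> K \<and> (\<forall>x\<in>?G. (\<Sum>k\<in>Q. indicator (block k) x) = (indicator A x :: real))
      \<and> (\<Sum>k\<in>Q. 1 / \<tau> k) \<le> 5 * real l" by blast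
  then obtain pt where pt: "\<And>A. A \<in> APs d N \<Longrightarrow> pt A \<subseteq> K"
    "\<And>A x. A \<in> APs d N \<Longrightarrow> x \<in> ?G \<Longrightarrow> (\<Sum>k\<in>pt A. indicator (block k) x) = (indicator A x :: real)"
    "\<And>A. A \<in> APs d N \<Longrightarrow> (\<Sum>k\<in>pt A. 1 / \<tau> k) \<le> 5 * real l"
    unfolding bchoice_iff by blast
  have "\<exists>\<epsilon>. (\<forall>x\<in>?G. \<bar>\<epsilon> x\<bar> = (1::real)) \<and> (\<forall>A\<in>APs d N. \<bar>\<Sum>x\<in>A. \<epsilon> x\<bar>
    \<le> sqrt (7 * 3 ^ d * (5 * real l)) * sqrt (2 * ln (2 * real (card (APs d N)))))"
  proof (rule discrepancy_via_blocks[where K = K and block = block and \<tau> = \<tau> and part = pt])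
    show "A \<subseteq> ?G \<and> pt A \<subseteq> K" if "A \<in> APs d N" for A
      using APs_subset_grid[OF that] pt(1)[OF that] by simp
  qed (use grid_finite fK APs_finite APs_nonempty[OF d N] l(1) in \<open>simp_all add: \<tau>pos T pt(2,3)\<close>)
  then obtain \<epsilon> where e: "\<forall>x\<in>?G. \<bar>\<epsilon> x\<bar> = (1::real)"
    "\<forall>A\<in>APs d N. \<bar>\<Sum>x\<in>A. \<epsilon> x\<bar> \<le> sqrt (7 * 3 ^ d * (5 * real l)) * sqrt (2 * ln (2 * real (card (APs d N))))"
    by blast
  define P where "P = real (\<Prod>i<d. N i)"
  have P2: "P \<ge> 2" using assms(3) unfolding P_def by (metis of_nat_le_iff of_nat_numeral)
  have cA: "1 \<le> real (card (APs d N))"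
    using APs_nonempty[OF d N] APs_finite by (metis One_nat_def Suc_leI card_gt_0_iff of_nat_1 of_nat_le_iff)
  have "real (card (APs d N)) \<le> P ^ 3"
    using APs_card_le[of d N] unfolding P_def by (metis of_nat_le_iff of_nat_power)
  \<comment> \<open>The factor 2 from the two signs is absorbed by one more factor P.\<close>
  then have "2 * real (card (APs d N)) \<le> P * P ^ 3" using P2 by (intro mult_mono) auto
  then have "ln (2 * real (card (APs d N))) \<le> ln (P ^ 4)"
    using cA P2 by (subst ln_le_cancel_iff) (auto simp: power_eq_if)
  then have lnb: "2 * ln (2 * real (card (APs d N))) \<le> 8 * ln P"
    using P2 by (simp add: ln_realpow)
  have "sqrt (7 * 3 ^ d * (5 * real l)) * sqrt (2 * ln (2 * real (card (APs d N))))
    = sqrt (7 * 3 ^ d * (5 * real l) * (2 * ln (2 * real (card (APs d N)))))" by (rule real_sqrt_mult[symmetric])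
  also have "\<dots> \<le> sqrt (7 * 3 ^ d * (5 * (2 * L)) * (8 * ln P))"
    by (rule real_sqrt_le_mono, rule mult_mono[OF _ lnb]) (use l cA L1 in auto)
  also have "7 * 3 ^ d * (5 * (2 * L)) * (8 * ln P) = 560 * 3 ^ d * L * ln P" by simp
  finally have "\<bar>\<Sum>x\<in>A. \<epsilon> x\<bar> \<le> sqrt (560 * 3 ^ d * L * ln P)" if "A \<in> APs d N" for A
    using e(2) that by (meson order_trans)
  then show ?thesis unfolding P_def using e(1) by (intro disc_AP_le[OF d N]) auto
qed

section \<open>Lower bound\<close>

text \<open>Choose coefficients one at a time, each larger than every value the earlier ones produce
  on \<open>Z\<close>. Applied to differences of points, it maps a finite set in several dimensions
  injectively and linearly to the integers, so one-dimensional Fourier analysis suffices.\<close>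

lemma separating_functional:
  fixes Z :: "('i \<Rightarrow> int) set"
  assumes "finite I" "finite Z" "\<And>z. z \<in> Z \<Longrightarrow> \<exists>i\<in>I. z i \<noteq> 0"
  shows "\<exists>c. \<forall>z\<in>Z. (\<Sum>i\<in>I. c i * z i) \<noteq> (0::int)"
  using assms
proof (induction I arbitrary: Z rule: finite_induct)
  case empty
  then show ?case by auto
next
  case (insert j I)
  define Z1 where "Z1 = {z\<in>Z. \<exists>i\<in>I. z i \<noteq> 0}"
  have "finite Z1" "\<And>z. z \<in> Z1 \<Longrightarrow> \<exists>i\<in>I. z i \<noteq> 0" using insert.prems(1) by (simp_all add: Z1_def)
  then obtain c where c: "\<forall>z\<in>Z1. (\<Sum>i\<in>I. c i * z i) \<noteq> 0"
    using insert.IH[of Z1] by blast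
  define C where "C = 1 + (\<Sum>z\<in>Z. \<bar>\<Sum>i\<in>I. c i * z i\<bar>)"
  define c' where "c' = c(j := C)"
  have eq: "(\<Sum>i\<in>insert j I. c' i * z i) = C * z j + (\<Sum>i\<in>I. c i * z i)" for z
  proof -
    have "(\<Sum>i\<in>I. c' i * z i) = (\<Sum>i\<in>I. c i * z i)"
      using insert.hyps by (intro sum.cong) (auto simp: c'_def)
    then show ?thesis using insert.hyps by (simp add: c'_def)
  qed
  have "(\<Sum>i\<in>insert j I. c' i * z i) \<noteq> 0" if z: "z \<in> Z" for z
  proof (cases "z j = 0")
    case True
    then have "z \<in> Z1" using insert.prems(2)[OF z] z by (auto simp: Z1_def)
    then show ?thesis unfolding eq using True c by auto
  next
    case False
    have "\<bar>\<Sum>i\<in>I. c i * z i\<bar> \<le> (\<Sum>z\<in>Z. \<bar>\<Sum>i\<in>I. c i * z i\<bar>)"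
      using z insert.prems(1) by (intro member_le_sum) auto
    then have "\<bar>\<Sum>i\<in>I. c i * z i\<bar> < C" unfolding C_def by linarith
    moreover have "C \<ge> 0" unfolding C_def by (intro add_nonneg_nonneg sum_nonneg) auto
    then have "C * 1 \<le> \<bar>C * z j\<bar>" using False unfolding abs_mult by (intro mult_mono) auto
    ultimately show ?thesis unfolding eq by linarith
  qed
  then show ?case by blast
qed

section \<open>Fourier analysis on a cyclic group\<close>

lemma sum_characters:
  assumes "Q > 0" "\<bar>n\<bar> < int Q"
  shows "(\<Sum>t<Q. cis (2 * pi * (real t / real Q) * of_int n)) = (if n = 0 then of_nat Q else 0)"
proof (cases "n = 0")
  case False
  define w where "w = cis (2 * pi * (of_int n / real Q))"
  have "w \<noteq> 1"
  proof
    assume "w = 1"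
    then have "Re w = 1" by simp
    then have "cos (2 * pi * (of_int n / real Q)) = 1" by (simp only: w_def cis.sel)
    then obtain m :: int where "2 * pi * (of_int n / real Q) = of_int m * 2 * pi"
      unfolding cos_one_2pi_int by blast
    then have "real_of_int n = of_int m * of_nat Q" using assms(1) by (simp add: field_simps)
    then have "n = m * int Q" by (metis of_int_eq_iff of_int_mult of_int_of_nat_eq)
    then show False using assms(2) False by (cases "m = 0") (auto simp: abs_mult)
  qed
  moreover have "real Q * (2 * pi * (of_int n / real Q)) = 2 * pi * of_int n" using assms(1) by simp
  then have "w ^ Q = 1" unfolding w_def Complex.DeMoivre by (simp only: cis_multiple_2pi Ints_of_int)
  ultimately have "(\<Sum>t<Q. w ^ t) = 0" by (simp add: geometric_sum)
  moreover have "w ^ t = cis (2 * pi * (real t / real Q) * of_int n)" for t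
    unfolding w_def Complex.DeMoivre by (simp add: mult_ac)
  ultimately show ?thesis using False by simp
qed simp

text \<open>Differences of values of \<open>\<phi>\<close> are smaller than \<open>Q\<close>, so no
  two points of \<open>W\<close> collide modulo \<open>Q\<close>, and orthogonality of characters
  removes all off-diagonal terms.\<close>

lemma finite_parseval:
  fixes \<phi> :: "'w \<Rightarrow> int" and g :: "'w \<Rightarrow> real"
  assumes "finite W" "Q > 0" "inj_on \<phi> W" "\<And>x y. x \<in> W \<Longrightarrow> y \<in> W \<Longrightarrow> \<bar>\<phi> x - \<phi> y\<bar> < int Q"
  shows "(\<Sum>t<Q. (cmod (\<Sum>x\<in>W. of_real (g x) * cis (2 * pi * (real t / real Q) * of_int (\<phi> x))))\<^sup>2)
    = real Q * (\<Sum>x\<in>W. (g x)\<^sup>2)"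
proof -
  let ?e = "\<lambda>t n. cis (2 * pi * (real t / real Q) * of_int n)"
  have "complex_of_real ((cmod (\<Sum>x\<in>W. of_real (g x) * ?e t (\<phi> x)))\<^sup>2)
    = (\<Sum>x\<in>W. \<Sum>y\<in>W. of_real (g x * g y) * ?e t (\<phi> x - \<phi> y))" for t
    unfolding complex_norm_square cnj_sum sum_product
    by (intro sum.cong) (auto simp: cis_cnj cis_mult algebra_simps diff_divide_distrib)
  then have "complex_of_real (\<Sum>t<Q. (cmod (\<Sum>x\<in>W. of_real (g x) * ?e t (\<phi> x)))\<^sup>2)
    = (\<Sum>t<Q. \<Sum>x\<in>W. \<Sum>y\<in>W. of_real (g x * g y) * ?e t (\<phi> x - \<phi> y))" by simp
  also have "\<dots> = (\<Sum>x\<in>W. \<Sum>y\<in>W. of_real (g x * g y) * (\<Sum>t<Q. ?e t (\<phi> x - \<phi> y)))"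
    by (subst sum.swap, rule sum.cong[OF refl], subst sum.swap) (simp add: sum_distrib_left)
  also have "\<dots> = (\<Sum>x\<in>W. \<Sum>y\<in>W. if x = y then of_real ((g x)\<^sup>2) * of_nat Q else 0)"
  proof (intro sum.cong refl)
    fix x y assume xy: "x \<in> W" "y \<in> W"
    have "\<phi> x - \<phi> y = 0 \<longleftrightarrow> x = y" using assms(3) xy by (auto dest: inj_onD)
    then show "of_real (g x * g y) * (\<Sum>t<Q. ?e t (\<phi> x - \<phi> y)) = (if x = y then of_real ((g x)\<^sup>2) * of_nat Q else 0)"
      unfolding sum_characters[OF assms(2) assms(4)[OF xy]] by (auto simp: power2_eq_square)
  qed
  also have "\<dots> = complex_of_real (real Q * (\<Sum>x\<in>W. (g x)\<^sup>2))"
    using assms(1) by (simp add: sum_distrib_left mult.commute)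
  finally show ?thesis by (simp only: of_real_eq_iff)
qed

text \<open>Near resonance keeps all \<open>m\<close> phases within a sixth of a turn, where the
  cosine is at least 1/2, so nothing cancels.\<close>

lemma dirichlet_kernel_lower:
  fixes \<alpha> :: real
  assumes "\<bar>\<alpha> - of_int k\<bar> \<le> \<eta>" "real (m - 1) * \<eta> \<le> 1 / 6"
  shows "real m / 2 \<le> cmod (\<Sum>j<m. cis (- (2 * pi * real j * \<alpha>)))"
proof -
  have "1 / 2 \<le> Re (cis (- (2 * pi * real j * \<alpha>)))" if j: "j < m" for j
  proof -
    define \<beta> where "\<beta> = \<alpha> - of_int k"
    have "cis (- (2 * pi * real j * \<alpha>)) = cis (- (2 * pi * real j * \<beta>)) * cis (2 * pi * of_int (- int j * k))"
      unfolding cis_mult \<beta>_def by (simp add: algebra_simps)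
    also have "\<dots> = cis (- (2 * pi * real j * \<beta>))" by (subst cis_multiple_2pi) auto
    finally have eq: "Re (cis (- (2 * pi * real j * \<alpha>))) = cos (\<bar>2 * pi * real j * \<beta>\<bar>)" by simp
    have "real j * \<bar>\<beta>\<bar> \<le> real (m - 1) * \<eta>"
      using j assms(1) by (intro mult_mono) (auto simp: \<beta>_def)
    then have "2 * pi * (real j * \<bar>\<beta>\<bar>) \<le> 2 * pi * (1 / 6)" using assms(2) by (intro mult_left_mono) auto
    then have "\<bar>2 * pi * real j * \<beta>\<bar> \<le> pi / 3" by (simp add: abs_mult)
    then have "cos (pi / 3) \<le> cos \<bar>2 * pi * real j * \<beta>\<bar>" by (intro cos_monotone_0_pi_le) auto
    then show ?thesis unfolding eq by (simp add: cos_60)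
  qed
  then have "(\<Sum>j<m. 1 / 2) \<le> (\<Sum>j<m. Re (cis (- (2 * pi * real j * \<alpha>))))" by (intro sum_mono) auto
  also have "\<dots> = Re (\<Sum>j<m. cis (- (2 * pi * real j * \<alpha>)))" by simp
  also have "\<dots> \<le> cmod (\<Sum>j<m. cis (- (2 * pi * real j * \<alpha>)))" by (rule complex_Re_le_cmod)
  finally show ?thesis by simp
qed

text \<open>Dirichlet's argument: one point more than bins of equal length in the unit
  interval.\<close>

lemma pigeonhole_fractional_parts:
  fixes h :: "'b \<Rightarrow> real"
  assumes "finite B" "card B \<ge> 2"
  obtains x y k where "x \<in> B" "y \<in> B" "x \<noteq> y" "\<bar>h x - h y - of_int k\<bar> \<le> 1 / real (card B - 1)"
proof -
  define n where "n = card B - 1"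
  have n: "n \<ge> 1" "card B = n + 1" using assms(2) by (auto simp: n_def)
  define bin where "bin x = \<lfloor>real n * frac (h x)\<rfloor>" for x
  have "bin ` B \<subseteq> {0..<int n}"
  proof
    fix z assume "z \<in> bin ` B"
    then obtain x where "z = bin x" by blast
    moreover have "real n * frac (h x) < real n * 1" using n frac_lt_1[of "h x"] by (intro mult_strict_left_mono) auto
    moreover have "0 \<le> real n * frac (h x)" by simp
    ultimately show "z \<in> {0..<int n}" unfolding bin_def by (simp add: floor_less_iff)
  qed
  then have "card (bin ` B) \<le> card {0..<int n}" by (intro card_mono) auto
  then have "\<not> inj_on bin B" using n by (intro pigeonhole) auto
  then obtain x y where xy: "x \<in> B" "y \<in> B" "x \<noteq> y" "bin x = bin y" by (auto simp: inj_on_def)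
  have "\<bar>real n * frac (h x) - real n * frac (h y)\<bar> \<le> 1" using xy(4) unfolding bin_def by linarith
  then have "real n * \<bar>frac (h x) - frac (h y)\<bar> \<le> 1" by (simp add: abs_mult flip: right_diff_distrib)
  then have "\<bar>frac (h x) - frac (h y)\<bar> \<le> 1 / real n" using n by (simp add: field_simps)
  then have "\<bar>h x - h y - of_int (\<lfloor>h x\<rfloor> - \<lfloor>h y\<rfloor>)\<bar> \<le> 1 / real n" by (simp add: frac_def algebra_simps)
  then show ?thesis using that xy unfolding n_def by blast
qed

text \<open>For fixed \<open>b\<close> the segment sums are a correlation of \<open>f\<close> with a
  progression, so their transform is that of \<open>f\<close> times a Dirichlet kernel. The resonant
  \<open>b\<close> depends on the frequency; summing the squared kernels over all of
  \<open>B\<close> gives a lower bound valid at every frequency. \<open>W\<close> holds every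
  starting point from which a segment can meet \<open>S\<close>.\<close>

lemma ap_energy_lower:
  fixes S W B :: "('i \<Rightarrow> int) set" and f :: "('i \<Rightarrow> int) \<Rightarrow> real"
  assumes fin: "finite I" "finite S" "finite W" "finite B"
    and f0: "\<And>x. x \<notin> S \<Longrightarrow> f x = 0"
    and SW: "S \<subseteq> W" "\<And>x b j. x \<in> S \<Longrightarrow> b \<in> B \<Longrightarrow> j < m \<Longrightarrow> (\<lambda>i. x i - int j * b i) \<in> W"
    and W: "\<And>x y. x \<in> W \<Longrightarrow> y \<in> W \<Longrightarrow> x \<noteq> y \<Longrightarrow> \<exists>i\<in>I. x i \<noteq> y i"
    and dir: "\<And>h :: 'i \<Rightarrow> real. \<exists>b\<in>B. \<exists>k. \<bar>(\<Sum>i\<in>I. h i * of_int (b i)) - of_int k\<bar> \<le> \<eta>"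
    and m: "real (m - 1) * \<eta> \<le> 1 / 6"
  shows "(real m)\<^sup>2 / 4 * (\<Sum>x\<in>S. (f x)\<^sup>2)
    \<le> (\<Sum>b\<in>B. \<Sum>y\<in>W. (\<Sum>j<m. f (\<lambda>i. y i + int j * b i))\<^sup>2)"
proof -
  define Z where "Z = (\<lambda>(x, y) i. x i - y i) ` {(x, y). x \<in> W \<and> y \<in> W \<and> x \<noteq> y}"
  have "finite Z" unfolding Z_def using fin(3)
    by (intro finite_imageI) (rule finite_subset[of _ "W \<times> W"], auto)
  moreover have "\<exists>i\<in>I. z i \<noteq> 0" if "z \<in> Z" for z using that W unfolding Z_def by fastforce
  ultimately obtain c where c: "\<forall>z\<in>Z. (\<Sum>i\<in>I. c i * z i) \<noteq> 0"
    using separating_functional[OF fin(1)] by blast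
  define \<phi> where "\<phi> x = (\<Sum>i\<in>I. c i * x i)" for x
  have inj: "inj_on \<phi> W"
  proof (rule inj_onI, rule ccontr)
    fix x y assume xy: "x \<in> W" "y \<in> W" "\<phi> x = \<phi> y" "x \<noteq> y"
    then have "(\<lambda>i. x i - y i) \<in> Z" unfolding Z_def by (intro image_eqI[of _ _ "(x, y)"]) auto
    from bspec[OF c this] show False using xy(3) by (simp add: \<phi>_def right_diff_distrib sum_subtractf)
  qed
  define Q where "Q = nat (1 + (\<Sum>p\<in>W \<times> W. \<bar>\<phi> (fst p) - \<phi> (snd p)\<bar>))"
  have nn: "0 \<le> (\<Sum>p\<in>W \<times> W. \<bar>\<phi> (fst p) - \<phi> (snd p)\<bar>)" by (intro sum_nonneg) auto
  have Q0: "Q > 0" using nn unfolding Q_def by linarith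
  have Q: "\<bar>\<phi> x - \<phi> y\<bar> < int Q" if "x \<in> W" "y \<in> W" for x y
  proof -
    have "\<bar>\<phi> (fst (x, y)) - \<phi> (snd (x, y))\<bar> \<le> (\<Sum>p\<in>W \<times> W. \<bar>\<phi> (fst p) - \<phi> (snd p)\<bar>)"
      using that fin by (intro member_le_sum) auto
    then show ?thesis using nn by (simp add: Q_def)
  qed
  define e where "e t n = cis (2 * pi * (real t / real Q) * of_int n)" for t n
  define F where "F t = (\<Sum>x\<in>S. of_real (f x) * e t (\<phi> x))" for t
  define D where "D t b = (\<Sum>j<m. cis (- (2 * pi * real j * (real t / real Q * of_int (\<phi> b)))))" for t b
  define g where "g b y = (\<Sum>j<m. f (\<lambda>i. y i + int j * b i))" for b y
  have \<phi>_shift: "\<phi> (\<lambda>i. x i - int j * b i) = \<phi> x - int j * \<phi> b" for x j b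
    by (simp add: \<phi>_def right_diff_distrib sum_subtractf sum_distrib_left mult_ac)
  have conv: "(\<Sum>y\<in>W. of_real (g b y) * e t (\<phi> y)) = F t * D t b" if b: "b \<in> B" for t b
  proof -
    have sh: "(\<Sum>y\<in>W. of_real (f (\<lambda>i. y i + int j * b i)) * e t (\<phi> y))
      = F t * cis (- (2 * pi * real j * (real t / real Q * of_int (\<phi> b))))" if j: "j < m" for j
    proof -
      let ?s = "\<lambda>x i. x i - int j * b i"
      have injs: "inj_on ?s S" by (auto simp: inj_on_def fun_eq_iff)
      have "(\<Sum>y\<in>W. of_real (f (\<lambda>i. y i + int j * b i)) * e t (\<phi> y))
        = (\<Sum>y\<in>?s ` S. of_real (f (\<lambda>i. y i + int j * b i)) * e t (\<phi> y))"
      proof (rule sum.mono_neutral_right)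
        show "?s ` S \<subseteq> W" using SW(2)[OF _ b j] by blast
        show "\<forall>y\<in>W - ?s ` S. of_real (f (\<lambda>i. y i + int j * b i)) * e t (\<phi> y) = 0"
        proof
          fix y assume y: "y \<in> W - ?s ` S"
          have "(\<lambda>i. y i + int j * b i) \<notin> S"
          proof
            assume "(\<lambda>i. y i + int j * b i) \<in> S"
            then have "?s (\<lambda>i. y i + int j * b i) \<in> ?s ` S" by (rule imageI)
            then show False using y by simp
          qed
          then show "of_real (f (\<lambda>i. y i + int j * b i)) * e t (\<phi> y) = 0" by (simp add: f0)
        qed
      qed fact
      also have "\<dots> = (\<Sum>x\<in>S. of_real (f x) * e t (\<phi> (?s x)))"
        by (subst sum.reindex[OF injs]) simp
      also have "\<dots> = (\<Sum>x\<in>S. of_real (f x) * e t (\<phi> x) * cis (- (2 * pi * real j * (real t / real Q * of_int (\<phi> b)))))"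
        unfolding \<phi>_shift e_def mult.assoc cis_mult by (simp add: algebra_simps)
      finally show ?thesis by (simp add: F_def sum_distrib_right)
    qed
    have "(\<Sum>y\<in>W. of_real (g b y) * e t (\<phi> y)) = (\<Sum>j<m. \<Sum>y\<in>W. of_real (f (\<lambda>i. y i + int j * b i)) * e t (\<phi> y))"
      unfolding g_def of_real_sum sum_distrib_right by (rule sum.swap)
    also have "\<dots> = (\<Sum>j<m. F t * cis (- (2 * pi * real j * (real t / real Q * of_int (\<phi> b)))))"
      using sh by (intro sum.cong) auto
    finally show ?thesis by (simp add: D_def sum_distrib_left)
  qed
  \<comment> \<open>At frequency t / Q the phase of \<open>b\<close> is linear in \<open>b\<close>
    with coefficients t c_i / Q, an instance of \<open>dir\<close>.\<close>
  have kernel: "(real m / 2)\<^sup>2 \<le> (\<Sum>b\<in>B. (cmod (D t b))\<^sup>2)" for t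
  proof -
    obtain b k where b: "b \<in> B" "\<bar>(\<Sum>i\<in>I. real t / real Q * of_int (c i) * of_int (b i)) - of_int k\<bar> \<le> \<eta>"
      using dir[of "\<lambda>i. real t / real Q * of_int (c i)"] by blast
    have "(\<Sum>i\<in>I. real t / real Q * of_int (c i) * of_int (b i)) = real t / real Q * of_int (\<phi> b)"
      by (simp add: \<phi>_def sum_distrib_left mult.assoc)
    with b(2) have "\<bar>real t / real Q * of_int (\<phi> b) - of_int k\<bar> \<le> \<eta>" by simp
    from dirichlet_kernel_lower[OF this m] have "(real m / 2)\<^sup>2 \<le> (cmod (D t b))\<^sup>2"
      unfolding D_def by (intro power_mono) auto
    also have "\<dots> \<le> (\<Sum>b\<in>B. (cmod (D t b))\<^sup>2)"
      using fin b by (intro member_le_sum) auto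
    finally show ?thesis .
  qed
  have "(\<Sum>x\<in>S. (f x)\<^sup>2) * (real Q * (real m / 2)\<^sup>2) = (\<Sum>t<Q. (cmod (F t))\<^sup>2) * (real m / 2)\<^sup>2"
    unfolding F_def e_def
    using finite_parseval[OF fin(2) Q0 inj_on_subset[OF inj SW(1)], of f] Q SW(1) by (simp add: subset_iff)
  also have "\<dots> = (\<Sum>t<Q. (cmod (F t))\<^sup>2 * (real m / 2)\<^sup>2)" by (rule sum_distrib_right)
  also have "\<dots> \<le> (\<Sum>t<Q. (cmod (F t))\<^sup>2 * (\<Sum>b\<in>B. (cmod (D t b))\<^sup>2))"
    using kernel by (intro sum_mono mult_left_mono) auto
  also have "\<dots> = (\<Sum>b\<in>B. \<Sum>t<Q. (cmod (F t * D t b))\<^sup>2)"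
    unfolding sum_distrib_left norm_mult power_mult_distrib by (rule sum.swap)
  also have "\<dots> = (\<Sum>b\<in>B. real Q * (\<Sum>y\<in>W. (g b y)\<^sup>2))"
  proof (rule sum.cong[OF refl])
    fix b assume b: "b \<in> B"
    show "(\<Sum>t<Q. (cmod (F t * D t b))\<^sup>2) = real Q * (\<Sum>y\<in>W. (g b y)\<^sup>2)"
      unfolding conv[OF b, symmetric] e_def by (rule finite_parseval[OF fin(3) Q0 inj Q])
  qed
  also have "\<dots> = real Q * (\<Sum>b\<in>B. \<Sum>y\<in>W. (g b y)\<^sup>2)" by (simp add: sum_distrib_left)
  finally have "real Q * ((real m)\<^sup>2 / 4 * (\<Sum>x\<in>S. (f x)\<^sup>2)) \<le> real Q * (\<Sum>b\<in>B. \<Sum>y\<in>W. (g b y)\<^sup>2)"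
    by (simp add: power_divide mult_ac)
  then show ?thesis using Q0 unfolding g_def by simp
qed


text \<open>A segment starting outside \<open>S\<close> may only partly lie in it. By the convexity
  hypothesis \<open>conv\<close> the indices inside form an interval, so the truncated sum runs over
  one genuine progression, or is empty.\<close>

lemma ap_segment_sum_le_disc:
  fixes f :: "(nat \<Rightarrow> int) \<Rightarrow> int"
  assumes f: "\<And>A. A \<in> APs d N \<Longrightarrow> \<bar>\<Sum>x\<in>A. f x\<bar> \<le> \<Delta>" and \<Delta>: "0 \<le> \<Delta>"
    and S: "S \<subseteq> grid d N" and b: "b \<in> zvec d" "b \<noteq> (\<lambda>_. 0)"
    and conv: "\<And>i j k. \<lbrakk>i \<le> j; j \<le> k; (\<lambda>t. y t + int i * b t) \<in> S; (\<lambda>t. y t + int k * b t) \<in> S\<rbrakk>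
      \<Longrightarrow> (\<lambda>t. y t + int j * b t) \<in> S"
  shows "\<bar>\<Sum>j<m. if (\<lambda>t. y t + int j * b t) \<in> S then f (\<lambda>t. y t + int j * b t) else 0\<bar> \<le> \<Delta>"
proof -
  define J where "J = {j\<in>{..<m}. (\<lambda>t. y t + int j * b t) \<in> S}"
  have fJ: "finite J" by (simp add: J_def)
  have sumJ: "(\<Sum>j<m. if (\<lambda>t. y t + int j * b t) \<in> S then f (\<lambda>t. y t + int j * b t) else 0)
    = (\<Sum>j\<in>J. f (\<lambda>t. y t + int j * b t))"
    unfolding J_def by (intro sum.mono_neutral_cong_right) auto
  show ?thesis
  proof (cases "J = {}")
    case True
    then show ?thesis unfolding sumJ using \<Delta> by simp
  next
    case False
    define p where "p = Min J"
    define q where "q = Max J"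
    have pq: "p \<in> J" "q \<in> J" "p \<le> q"
      using fJ False by (auto simp: p_def q_def)
    have "J = {p..q}"
    proof
      show "J \<subseteq> {p..q}" using fJ by (auto simp: p_def q_def)
      show "{p..q} \<subseteq> J"
      proof
        fix j assume j: "j \<in> {p..q}"
        then have "(\<lambda>t. y t + int j * b t) \<in> S" using pq by (intro conv[of p j q]) (auto simp: J_def)
        then show "j \<in> J" using j pq by (auto simp: J_def)
      qed
    qed
    also have "{p..q} = (\<lambda>i. p + i) ` {..<q - p + 1}"
    proof
      show "{p..q} \<subseteq> (\<lambda>i. p + i) ` {..<q - p + 1}"
      proof
        fix j assume "j \<in> {p..q}"
        then show "j \<in> (\<lambda>i. p + i) ` {..<q - p + 1}" by (intro image_eqI[of _ _ "j - p"]) auto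
      qed
    qed (use pq in auto)
    finally have J: "J = (\<lambda>i. p + i) ` {..<q - p + 1}" .
    define a where "a = (\<lambda>t. y t + int p * b t)"
    have eq: "(\<lambda>t. y t + int (p + i) * b t) = (\<lambda>t. a t + int i * b t)" for i
      by (auto simp: a_def algebra_simps)
    let ?A = "ap_set a b (q - p + 1)"
    have A: "?A = (\<lambda>i t. a t + int i * b t) ` {..<q - p + 1}" by (auto simp: ap_set_def)
    have AS: "?A \<subseteq> S"
    proof
      fix x assume "x \<in> ?A"
      then obtain i where i: "i < q - p + 1" "x = (\<lambda>t. y t + int (p + i) * b t)" unfolding A eq by blast
      then have "p + i \<in> J" unfolding J by blast
      then show "x \<in> S" unfolding i(2) by (simp add: J_def)
    qed
    have "a \<in> S" using pq(1) by (simp add: J_def a_def)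
    then have "a \<in> zvec d" using S grid_subset_zvec by blast
    then have "?A \<in> APs d N"
      unfolding APs_def using AS S b by (intro CollectI exI[of _ a] exI[of _ b] exI[of _ "q - p + 1"]) auto
    moreover have "(\<Sum>x\<in>?A. f x) = (\<Sum>j\<in>J. f (\<lambda>t. y t + int j * b t))"
    proof -
      have "(\<Sum>x\<in>?A. f x) = (\<Sum>i<q - p + 1. f (\<lambda>t. a t + int i * b t))"
        unfolding A by (subst sum.reindex[OF inj_on_subset[OF ap_inj[OF b(2), of a]]]) auto
      also have "\<dots> = (\<Sum>j\<in>J. f (\<lambda>t. y t + int j * b t))"
        unfolding J by (subst sum.reindex) (auto simp: eq simp del: of_nat_add)
      finally show ?thesis .
    qed
    ultimately show ?thesis unfolding sumJ using f by metis
  qed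
qed

text \<open>The hypothesis that every side is at least L holds for the index set maximising the
  lower bound.\<close>

lemma disc_AP_ge_scale:
  assumes d: "d > 0" and N: "\<forall>i<d. N i > 0" and I: "I \<subseteq> {..<d}" "I \<noteq> {}"
    and L: "L \<ge> 1" "(\<Prod>i\<in>I. real (N i)) = L ^ (card I + 1)" "\<And>i. i \<in> I \<Longrightarrow> L \<le> real (N i)"
  shows "L \<le> 576 * 6 ^ d * (real_of_int (disc_AP d N))\<^sup>2"
proof -
  define M where "M i = nat \<lfloor>real (N i) / L\<rfloor>" for i
  \<comment> \<open>Since \<open>card B0 - 1\<close> will be at least L / 2, resonance holds up to 2
    / L, and m - 1 <= L / 12 meets the bound 1/6 of the kernel estimate.\<close>
  define m where "m = nat \<lfloor>L / 12\<rfloor> + 1"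
  have m: "real (m - 1) \<le> L / 12" "L / 12 \<le> real m" "m \<ge> 1" using L(1) unfolding m_def by (simp_all, linarith+)
  have M: "M i \<ge> 1" "real (M i) \<le> real (N i) / L" "real (N i) / L \<le> real (M i) + 1" if "i \<in> I" for i
  proof -
    have "1 \<le> real (N i) / L" using L(3)[OF that] L(1) by simp
    then show "M i \<ge> 1" "real (M i) \<le> real (N i) / L" "real (N i) / L \<le> real (M i) + 1"
      unfolding M_def by linarith+
  qed
  have fI: "finite I" using I finite_subset by blast
  have kd: "card I \<le> d" using card_mono[OF _ I(1)] by simp
  \<comment> \<open>Coordinates outside \<open>I\<close> are frozen: at 1 within the grid, at 0
    beyond dimension \<open>d\<close>.\<close>
  define c0 where "c0 i = (if i < d then 1 else 0 :: int)" for i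
  define S where "S = {x. (\<forall>i\<in>I. x i \<in> {1..int (N i)}) \<and> (\<forall>i. i \<notin> I \<longrightarrow> x i = c0 i)}"
  \<comment> \<open>The farthest that m - 1 steps can travel in coordinate \<open>i\<close>; it pads
    \<open>S\<close> to \<open>W\<close>.\<close>
  define R where "R i = int (m - 1) * int (M i)" for i
  define W where "W = {x. (\<forall>i\<in>I. x i \<in> {1 - R i..int (N i) + R i}) \<and> (\<forall>i. i \<notin> I \<longrightarrow> x i = c0 i)}"
  define B1 where "B1 = {x. (\<forall>i\<in>I. x i \<in> {- int (M i)..int (M i)}) \<and> (\<forall>i. i \<notin> I \<longrightarrow> x i = 0)}"
  define B where "B = B1 - {\<lambda>_. 0}"
  \<comment> \<open>The box for the pigeonhole principle; differences of two of its distinct points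
    lie in \<open>B\<close>.\<close>
  define B0 where "B0 = {x. (\<forall>i\<in>I. x i \<in> {0..int (M i)}) \<and> (\<forall>i. i \<notin> I \<longrightarrow> x i = 0)}"
  have fin: "finite S" "finite W" "finite B1" "finite B0"
    unfolding S_def W_def B1_def B0_def by (rule box_finite[OF fI]; simp)+
  have fB: "finite B" using fin by (simp add: B_def)
  have R0: "R i \<ge> 0" for i by (simp add: R_def)
  have SG: "S \<subseteq> grid d N"
  proof
    fix x assume x: "x \<in> S"
    have "1 \<le> x i \<and> x i \<le> int (N i)" if "i < d" for i
      using x N that by (cases "i \<in> I") (auto simp: S_def c0_def Suc_le_eq)
    moreover have "x i = 0" if "i \<ge> d" for i
    proof -
      have "i \<notin> I" using I(1) that by auto
      then show ?thesis using x that by (simp add: S_def c0_def)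
    qed
    ultimately show "x \<in> grid d N" by (simp add: grid_def)
  qed
  obtain \<epsilon> where chi: "\<And>x. x \<in> grid d N \<Longrightarrow> \<epsilon> x \<in> {1, -1 :: int}"
    "\<And>A. A \<in> APs d N \<Longrightarrow> \<bar>\<Sum>x\<in>A. \<epsilon> x\<bar> \<le> disc_AP d N"
    using disc_AP_attained[OF d N] by blast
  have disc0: "0 \<le> disc_AP d N"
    using APs_nonempty[OF d N] chi(2) by (meson abs_ge_zero all_not_in_conv order_trans)
  define f where "f x = (if x \<in> S then \<epsilon> x else 0)" for x
  have BZ: "b \<in> zvec d" "b \<noteq> (\<lambda>_. 0)" if "b \<in> B" for b
  proof -
    have "b i = 0" if "i \<ge> d" for i
    proof -
      have "i \<notin> I" using I(1) that by auto
      then show ?thesis using \<open>b \<in> B\<close> by (simp add: B_def B1_def)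
    qed
    then show "b \<in> zvec d" "b \<noteq> (\<lambda>_. 0)" using \<open>b \<in> B\<close> by (simp_all add: zvec_def B_def)
  qed
  have Bb: "\<bar>b i\<bar> \<le> int (M i)" if "b \<in> B" "i \<in> I" for b i
  proof -
    have "b i \<in> {- int (M i)..int (M i)}" using that by (simp add: B_def B1_def)
    then show ?thesis by (auto simp: abs_le_iff)
  qed
  have conv: "(\<lambda>t. y t + int j * b t) \<in> S"
    if h: "i \<le> j" "j \<le> k" "(\<lambda>t. y t + int i * b t) \<in> S" "(\<lambda>t. y t + int k * b t) \<in> S" "b \<in> B" for y b i j k
  proof -
    have b0: "b t = 0" if "t \<notin> I" for t using \<open>b \<in> B\<close> that by (auto simp: B_def B1_def)
    have "1 \<le> y t + int j * b t \<and> y t + int j * b t \<le> int (N t)" if t: "t \<in> I" for t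
    proof -
      have e: "1 \<le> y t + int i * b t" "y t + int i * b t \<le> int (N t)"
        "1 \<le> y t + int k * b t" "y t + int k * b t \<le> int (N t)"
        using h t by (auto simp: S_def)
      show ?thesis
      proof (cases "b t \<ge> 0")
        case True
        then have "int i * b t \<le> int j * b t" "int j * b t \<le> int k * b t"
          using h(1,2) by (simp_all add: mult_right_mono)
        then show ?thesis using e by linarith
      next
        case False
        then have "int j * b t \<le> int i * b t" "int k * b t \<le> int j * b t"
          using h(1,2) by (simp_all add: mult_right_mono_neg)
        then show ?thesis using e by linarith
      qed
    qed
    moreover have "y t + int j * b t = c0 t" if "t \<notin> I" for t
    proof -
      have "y t + int i * b t = c0 t" using h(3) that by (simp add: S_def)
      then show ?thesis using b0[OF that] by simp
    qed
    ultimately show ?thesis by (simp add: S_def)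
  qed
  have seg: "(\<Sum>j<m. real_of_int (f (\<lambda>i. y i + int j * b i)))\<^sup>2 \<le> (real_of_int (disc_AP d N))\<^sup>2"
    if "b \<in> B" for b y
  proof -
    have "\<bar>\<Sum>j<m. f (\<lambda>i. y i + int j * b i)\<bar> \<le> disc_AP d N"
      unfolding f_def
      by (rule ap_segment_sum_le_disc[OF _ disc0 SG BZ[OF that]]) (rule chi(2) conv[OF _ _ _ _ that], assumption+)+
    then have "\<bar>\<Sum>j<m. real_of_int (f (\<lambda>i. y i + int j * b i))\<bar> \<le> real_of_int (disc_AP d N)"
      unfolding of_int_sum[symmetric] of_int_abs[symmetric] of_int_le_iff .
    from power_mono[OF this, of 2] show ?thesis by simp
  qed
  have cB0: "card B0 = (\<Prod>i\<in>I. M i + 1)"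
    unfolding B0_def by (subst box_card[OF fI]) (auto simp: nat_add_distrib intro!: prod.cong)
  \<comment> \<open>Dividing the product L^(|I|+1) of the sides once by \<open>L\<close> for each
    index leaves exactly \<open>L\<close>.\<close>
  have B0L: "L \<le> real (card B0)"
  proof -
    have "L ^ card I * L = (\<Prod>i\<in>I. real (N i))" using L(2) by simp
    also have "\<dots> = (\<Prod>i\<in>I. L * (real (N i) / L))" using L(1) by (intro prod.cong) auto
    also have "\<dots> = L ^ card I * (\<Prod>i\<in>I. real (N i) / L)" by (simp only: prod.distrib prod_constant)
    finally have "L = (\<Prod>i\<in>I. real (N i) / L)" using L(1) by simp
    also have "\<dots> \<le> (\<Prod>i\<in>I. real (M i + 1))" using M(3) L(1) by (intro prod_mono) (auto simp: add.commute)
    finally show ?thesis unfolding cB0 by simp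
  qed
  have B02: "card B0 \<ge> 2"
  proof -
    obtain i where i: "i \<in> I" using I(2) by blast
    have "M i + 1 dvd card B0" unfolding cB0 using fI i by (intro dvd_prodI) auto
    moreover have "card B0 > 0" unfolding cB0 by (intro prod_pos) auto
    ultimately have "M i + 1 \<le> card B0" by (rule dvd_imp_le)
    then show ?thesis using M(1)[OF i] by linarith
  qed
  define \<eta> where "\<eta> = 1 / real (card B0 - 1)"
  have m\<eta>: "real (m - 1) * \<eta> \<le> 1 / 6"
  proof -
    have "real (card B0 - 1) \<ge> real (card B0) / 2" using B02 by (simp add: of_nat_diff)
    then have "L / 12 \<le> real (card B0 - 1) / 6" using B0L by linarith
    then have "real (m - 1) \<le> real (card B0 - 1) / 6" using m(1) by linarith
    then show ?thesis using B02 by (simp add: \<eta>_def field_simps)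
  qed
  have dir: "\<exists>b\<in>B. \<exists>k. \<bar>(\<Sum>i\<in>I. h i * of_int (b i)) - of_int k\<bar> \<le> \<eta>" for h :: "nat \<Rightarrow> real"
  proof -
    obtain x y k where xy: "x \<in> B0" "y \<in> B0" "x \<noteq> y"
      "\<bar>(\<Sum>i\<in>I. h i * of_int (x i)) - (\<Sum>i\<in>I. h i * of_int (y i)) - of_int k\<bar> \<le> 1 / real (card B0 - 1)"
      using pigeonhole_fractional_parts[OF fin(4) B02, of "\<lambda>x. \<Sum>i\<in>I. h i * of_int (x i)"] by metis
    have "(\<lambda>i. x i - y i) \<in> B1" using xy(1,2) unfolding B0_def B1_def by fastforce
    moreover have "(\<lambda>i. x i - y i) \<noteq> (\<lambda>_. 0)" using xy(3) by (auto simp: fun_eq_iff)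
    moreover have "(\<Sum>i\<in>I. h i * of_int (x i - y i)) = (\<Sum>i\<in>I. h i * of_int (x i)) - (\<Sum>i\<in>I. h i * of_int (y i))"
      by (simp add: right_diff_distrib sum_subtractf)
    ultimately show ?thesis using xy(4) unfolding B_def \<eta>_def by (intro bexI[of _ "\<lambda>i. x i - y i"]) auto
  qed
  have energy: "(real m)\<^sup>2 / 4 * (\<Sum>x\<in>S. (real_of_int (f x))\<^sup>2)
    \<le> (\<Sum>b\<in>B. \<Sum>y\<in>W. (\<Sum>j<m. real_of_int (f (\<lambda>i. y i + int j * b i)))\<^sup>2)"
  proof (rule ap_energy_lower[OF fI fin(1,2) fB, where \<eta> = \<eta>])
    show "S \<subseteq> W" 
    proof
      fix x assume x: "x \<in> S"
      have "x i \<in> {1 - R i..int (N i) + R i}" if "i \<in> I" for i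
      proof -
        have "1 \<le> x i" "x i \<le> int (N i)" using x that by (simp_all add: S_def)
        with R0[of i] show ?thesis by simp
      qed
      then show "x \<in> W" using x by (simp add: W_def S_def)
    qed
    show "(\<lambda>i. x i - int j * b i) \<in> W" if "x \<in> S" "b \<in> B" "j < m" for x b j
    proof -
      have le: "\<bar>int j * b i\<bar> \<le> R i" if i: "i \<in> I" for i
        unfolding abs_mult R_def using Bb[OF \<open>b \<in> B\<close> i] \<open>j < m\<close> by (intro mult_mono) auto
      have "x i - int j * b i \<in> {1 - R i..int (N i) + R i}" if i: "i \<in> I" for i
      proof -
        have "1 \<le> x i" "x i \<le> int (N i)" using \<open>x \<in> S\<close> i by (simp_all add: S_def)
        with le[OF i] show ?thesis by auto
      qed
      then show ?thesis using that by (simp add: W_def S_def B_def B1_def)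
    qed
    show "\<exists>i\<in>I. x i \<noteq> y i" if "x \<in> W" "y \<in> W" "x \<noteq> y" for x y
    proof (rule ccontr)
      assume "\<not> ?thesis"
      then have "x i = y i" for i using that(1,2) by (cases "i \<in> I") (auto simp: W_def)
      then show False using that(3) by auto
    qed
  qed (use dir m\<eta> in \<open>auto simp: f_def\<close>)
  have cS: "(\<Sum>x\<in>S. (real_of_int (f x))\<^sup>2) = (\<Prod>i\<in>I. real (N i))"
  proof -
    have "(\<Sum>x\<in>S. (real_of_int (f x))\<^sup>2) = (\<Sum>x\<in>S. 1)"
    proof (rule sum.cong)
      fix x assume x: "x \<in> S"
      then have "x \<in> grid d N" using SG by blast
      then show "(real_of_int (f x))\<^sup>2 = 1" using chi(1)[of x] x by (auto simp: f_def)
    qed simp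
    also have "\<dots> = real (card S)" by simp
    also have "card S = (\<Prod>i\<in>I. N i)" unfolding S_def by (subst box_card[OF fI]) auto
    finally show ?thesis by simp
  qed
  have cW: "real (card W) \<le> 2 ^ card I * (\<Prod>i\<in>I. real (N i))"
  proof -
    have "card W = (\<Prod>i\<in>I. N i + 2 * ((m - 1) * M i))"
      unfolding W_def by (subst box_card[OF fI]) (auto simp: R_def nat_add_distrib nat_mult_distrib intro!: prod.cong)
    then have "real (card W) = (\<Prod>i\<in>I. real (N i) + 2 * (real (m - 1) * real (M i)))" by simp
    also have "\<dots> \<le> (\<Prod>i\<in>I. 2 * real (N i))"
    proof (rule prod_mono)
      fix i assume i: "i \<in> I"
      \<comment> \<open>The padding is at most a twelfth of the side at each end, so it enlarges a
        side by less than a factor 2.\<close>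
      have "real (m - 1) * real (M i) \<le> (L / 12) * (real (N i) / L)"
        using m(1) M(2)[OF i] L(1) by (intro mult_mono) auto
      also have "\<dots> = real (N i) / 12" using L(1) by simp
      finally show "0 \<le> real (N i) + 2 * (real (m - 1) * real (M i)) \<and>
        real (N i) + 2 * (real (m - 1) * real (M i)) \<le> 2 * real (N i)" by auto
    qed
    finally show ?thesis by (simp add: prod.distrib)
  qed
  have cB: "real (card B) \<le> 3 ^ card I * L"
  proof -
    have "card B \<le> card B1" using fin by (intro card_mono) (auto simp: B_def)
    also have "card B1 = (\<Prod>i\<in>I. 2 * M i + 1)"
      unfolding B1_def by (subst box_card[OF fI]) (auto simp: nat_add_distrib nat_mult_distrib intro!: prod.cong)
    finally have "real (card B) \<le> (\<Prod>i\<in>I. real (2 * M i + 1))" by (metis of_nat_le_iff of_nat_prod)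
    also have "\<dots> \<le> (\<Prod>i\<in>I. 3 * (real (N i) / L))"
    proof (rule prod_mono)
      fix i assume i: "i \<in> I"
      show "0 \<le> real (2 * M i + 1) \<and> real (2 * M i + 1) \<le> 3 * (real (N i) / L)"
        using M(1,2)[OF i] by auto
    qed
    also have "\<dots> = 3 ^ card I * ((\<Prod>i\<in>I. real (N i)) / L ^ card I)"
      by (simp only: prod.distrib prod_constant prod_dividef)
    also have "\<dots> = 3 ^ card I * L" unfolding L(2) using L(1) by simp
    finally show ?thesis .
  qed
  define p where "p = (\<Prod>i\<in>I. real (N i))"
  have p: "p > 0" unfolding p_def L(2) using L(1) by simp
  let ?\<Delta> = "(real_of_int (disc_AP d N))\<^sup>2"
  have "(L / 12)\<^sup>2 / 4 * p \<le> (real m)\<^sup>2 / 4 * p"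
    using m(2) L(1) p by (intro mult_right_mono divide_right_mono power_mono) auto
  also have "\<dots> \<le> (\<Sum>b\<in>B. \<Sum>y\<in>W. ?\<Delta>)"
    using energy seg unfolding cS p_def by (meson order_trans sum_mono)
  also have "\<dots> = real (card B) * (real (card W) * ?\<Delta>)" by simp
  also have "\<dots> \<le> (3 ^ card I * L) * ((2 ^ card I * p) * ?\<Delta>)"
    using cB cW L(1) unfolding p_def by (intro mult_mono) auto
  also have "\<dots> = L * p * (6 ^ card I * ?\<Delta>)" by (simp add: power_mult_distrib[symmetric])
  also have "\<dots> \<le> L * p * (6 ^ d * ?\<Delta>)"
    using kd L(1) p by (intro mult_left_mono mult_right_mono power_increasing) auto
  \<comment> \<open>576 is 4 * 12^2; the base 6 combines 3 from counting differences with 2 from the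
    padding.\<close>
  finally have "L * p * (L / 576) \<le> L * p * (6 ^ d * ?\<Delta>)" by (simp add: power2_eq_square mult_ac)
  then show ?thesis using L(1) p by simp
qed

section \<open>Both bounds in terms of the maximum over index sets\<close>

text \<open>Used with t = ln P to trade the factor sqrt (log P) for log P / log log P.\<close>

lemma sqrt_le_div_ln:
  assumes "t > (1::real)"
  shows "sqrt t \<le> 2 * (t / ln t)"
proof -
  have "ln t = 2 * ln (sqrt t)" using assms by (simp add: ln_sqrt)
  also have "ln (sqrt t) \<le> sqrt t - 1" using assms by (intro ln_le_minus_one) auto
  finally have "ln t \<le> 2 * sqrt t" by simp
  then have "sqrt t * ln t \<le> sqrt t * (2 * sqrt t)" using assms by (intro mult_left_mono) auto
  also have "\<dots> = 2 * t" using assms by simp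
  finally show ?thesis using assms by (simp add: field_simps)
qed

lemma disc_AP_ge_one:
  assumes "d > 0" "\<forall>i<d. N i > 0"
  shows "1 \<le> disc_AP d N"
proof -
  obtain c where c: "\<And>x. x \<in> grid d N \<Longrightarrow> c x \<in> {1, -1 :: int}"
    "\<And>A. A \<in> APs d N \<Longrightarrow> \<bar>\<Sum>x\<in>A. c x\<bar> \<le> disc_AP d N"
    using disc_AP_attained[OF assms] by blast
  obtain x where x: "x \<in> grid d N" using grid_nonempty[OF assms(2)] by blast
  show ?thesis using c(1)[OF x] c(2)[OF singleton_in_APs[OF assms(1) x]] by auto
qed

theorem theorem1p3:
  shows "\<forall>d::nat. d > 0 \<longrightarrow> (\<exists>c::real > 0. \<exists>C::real > 0. \<forall>N::nat \<Rightarrow> nat.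
     (\<forall>i<d. N i > 0) \<and> (\<Prod>i<d. N i) \<ge> 3 \<longrightarrow>
     (let P = real (\<Prod>i<d. N i);
          M = Max ((\<lambda>I. (\<Prod>i\<in>I. real (N i)) powr (1 / (2 * real (card I) + 2))) ` Pow {..<d})
      in c * M \<le> real_of_int (disc_AP d N) \<and>
         real_of_int (disc_AP d N) \<le> C * (ln P / ln (ln P)) * M))"
proof (intro allI impI)
  fix d :: nat assume d: "d > 0"
  \<comment> \<open>The square root of the constant in \<open>disc_AP_ge_scale\<close>, which bounds
    M^2.\<close>
  define K where "K = 24 * sqrt (6 ^ d :: real)"
  have "sqrt (6 ^ d) \<ge> (1::real)" by simp
  then have "K \<ge> 1" unfolding K_def by linarith
  moreover have "K\<^sup>2 = 576 * 6 ^ d" by (simp add: K_def power_mult_distrib)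
  ultimately have K: "K \<ge> 1" "K\<^sup>2 = 576 * 6 ^ d" .
  define C where "C = 2 * sqrt (560 * 3 ^ d :: real)"
  have bounds: "1 / K * M \<le> real_of_int (disc_AP d N) \<and> real_of_int (disc_AP d N) \<le> C * (ln P / ln (ln P)) * M"
    if N: "\<forall>i<d. N i > 0" "(\<Prod>i<d. N i) \<ge> 3" and P: "P = real (\<Prod>i<d. N i)"
      and M: "M = Max ((\<lambda>I. (\<Prod>i\<in>I. real (N i)) powr (1 / (2 * real (card I) + 2))) ` Pow {..<d})"
    for N P M
  proof -
    define F where "F I = (\<Prod>i\<in>I. real (N i)) powr (1 / (2 * real (card I) + 2))" for I
    have M_max: "M = Max (F ` Pow {..<d})" unfolding M F_def ..
    have FM: "F I \<le> M" if "I \<subseteq> {..<d}" for I unfolding M_max using that by (intro Max_ge) auto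
    have "M \<in> F ` Pow {..<d}" unfolding M_max by (intro Max_in) auto
    then obtain I where I: "I \<subseteq> {..<d}" "M = F I" by blast
    have M1: "M \<ge> 1" using FM[of "{}"] by (simp add: F_def)
    have pos: "(\<Prod>i\<in>J. real (N i)) > 0" if "J \<subseteq> {..<d}" for J
      using N(1) that by (intro prod_pos) auto
    \<comment> \<open>The exponent of \<open>F\<close> is designed for this: in terms of L = M^2,
      maximality of M becomes the subproduct bound used in \<open>disc_AP_le_scale\<close>.\<close>
    have Fpow: "(F J)\<^sup>2 ^ (card J + 1) = (\<Prod>i\<in>J. real (N i))" if "J \<subseteq> {..<d}" for J
    proof -
      have "(F J)\<^sup>2 ^ (card J + 1) = F J ^ (2 * (card J + 1))" by (rule power_mult[symmetric])
      also have "\<dots> = (\<Prod>i\<in>J. real (N i)) powr (real (2 * (card J + 1)) * (1 / (2 * real (card J) + 2)))"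
        unfolding F_def using pos[OF that] by (intro powr_power disjI1) simp
      also have "real (2 * (card J + 1)) * (1 / (2 * real (card J) + 2)) = 1" by (simp add: field_simps)
      finally show ?thesis unfolding powr_one[OF less_imp_le[OF pos[OF that]]] .
    qed
    define L where "L = M\<^sup>2"
    have L1: "L \<ge> 1" using M1 by (simp add: L_def)
    have L: "(\<Prod>i\<in>J. real (N i)) \<le> L ^ (card J + 1)" if "J \<subseteq> {..<d}" for J
      unfolding Fpow[OF that, symmetric] L_def using FM[OF that]
      by (intro power_mono) (auto simp: F_def)
    have "M \<le> K * real_of_int (disc_AP d N)"
    proof (cases "I = {}")
      case True
      \<comment> \<open>The empty product gives M = 1, and a single point already has discrepancy
        1.\<close>
      then have "M * 1 \<le> K * real_of_int (disc_AP d N)"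
        using I(2) K(1) disc_AP_ge_one[OF d N(1)] M1 by (intro mult_mono) (auto simp: F_def)
      then show ?thesis by simp
    next
      case False
      have fI: "finite I" using I finite_subset by blast
      have prodI: "(\<Prod>i\<in>I. real (N i)) = L ^ (card I + 1)" using Fpow[OF I(1)] I(2) by (simp add: L_def)
      \<comment> \<open>Maximality against \<open>I\<close> without \<open>i\<close>: the product
        over \<open>I\<close> is L^(|I|+1), and without \<open>i\<close> it is at most
        L^|I|.\<close>
      have "L \<le> real (N i)" if i: "i \<in> I" for i
      proof -
        have "L * L ^ card I = (\<Prod>j\<in>I. real (N j))" unfolding prodI by simp
        also have "\<dots> = real (N i) * (\<Prod>j\<in>I - {i}. real (N j))" by (rule prod.remove[OF fI i])
        also have "\<dots> \<le> real (N i) * L ^ (card (I - {i}) + 1)"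
          by (rule mult_left_mono[OF L]) (use I(1) in auto)
        also have "card (I - {i}) + 1 = card I" using card_Suc_Diff1[OF fI i] by simp
        finally show ?thesis by (rule mult_right_le_imp_le) (use L1 in simp)
      qed
      from disc_AP_ge_scale[OF d N(1) I(1) False L1 prodI this]
      have "M\<^sup>2 \<le> (K * real_of_int (disc_AP d N))\<^sup>2" by (simp add: L_def power_mult_distrib K(2))
      moreover have "0 \<le> K * real_of_int (disc_AP d N)"
        using K(1) disc_AP_ge_one[OF d N(1)] by (intro mult_nonneg_nonneg) simp_all
      ultimately show ?thesis by (rule power2_le_imp_le)
    qed
    then have lower: "1 / K * M \<le> real_of_int (disc_AP d N)" using K(1) by (simp add: field_simps)
    have P3: "P \<ge> 3" using N(2) unfolding P by (metis of_nat_le_iff of_nat_numeral)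
    then have "ln 3 \<le> ln P" by (subst ln_le_cancel_iff) auto
    then have lnP: "ln P > 1" using ln3_gt_1 by linarith
    have "real_of_int (disc_AP d N) \<le> sqrt (560 * 3 ^ d * L * ln P)"
      unfolding P using N(2) by (intro disc_AP_le_scale[OF d N(1) _ L1 L]) auto
    also have "\<dots> = sqrt (560 * 3 ^ d) * M * sqrt (ln P)"
      using M1 by (simp add: real_sqrt_mult L_def)
    also have "\<dots> \<le> sqrt (560 * 3 ^ d) * M * (2 * (ln P / ln (ln P)))"
      using M1 sqrt_le_div_ln[OF lnP] by (intro mult_left_mono) auto
    also have "\<dots> = C * (ln P / ln (ln P)) * M" by (simp add: C_def)
    finally show ?thesis using lower by simp
  qed
  have "\<forall>N::nat \<Rightarrow> nat. (\<forall>i<d. N i > 0) \<and> (\<Prod>i<d. N i) \<ge> 3 \<longrightarrow>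
     (let P = real (\<Prod>i<d. N i);
          M = Max ((\<lambda>I. (\<Prod>i\<in>I. real (N i)) powr (1 / (2 * real (card I) + 2))) ` Pow {..<d})
      in 1 / K * M \<le> real_of_int (disc_AP d N) \<and>
         real_of_int (disc_AP d N) \<le> C * (ln P / ln (ln P)) * M)"
    unfolding Let_def by (intro allI impI, elim conjE) (rule bounds[OF _ _ refl refl])
  moreover have "0 < 1 / K" "0 < C" using K(1) by (simp_all add: C_def)
  ultimately show "\<exists>c::real > 0. \<exists>C::real > 0. \<forall>N::nat \<Rightarrow> nat.
     (\<forall>i<d. N i > 0) \<and> (\<Prod>i<d. N i) \<ge> 3 \<longrightarrow>
     (let P = real (\<Prod>i<d. N i);
          M = Max ((\<lambda>I. (\<Prod>i\<in>I. real (N i)) powr (1 / (2 * real (card I) + 2))) ` Pow {..<d})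
      in c * M \<le> real_of_int (disc_AP d N) \<and>
         real_of_int (disc_AP d N) \<le> C * (ln P / ln (ln P)) * M)"
    by blast
qed

end
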